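(* Let $(H,\Delta,\epsilon,\Phi,S,\alpha,\beta)$ be a quasi-triangular quasi-Hopf algebra with $R$-matrix $\mathcal{R}$. Then $\mathcal{R}^T\mathcal{R}$ and all its powers $(\mathcal{R}^T\mathcal{R})^m$, $m\in\mathbb{Z}$, are compatible twists on $H$.
   Context: A quasi-bialgebra $(H,\Delta,\epsilon,\Phi)$ over a field $k$ is a unital associative $k$-algebra $H$ with algebra homomorphisms $\epsilon:H\to k$, $\Delta:H\to H\otimes H$ and an invertible $\Phi\in H\otimes H\otimes H$ such that (with $1$ also denoting the identity map) $(1\otimes\Delta)\Delta(a)=\Phi^{-1}(\Delta\otimes 1)\Delta(a)\Phi$ for all $a\in H$; $(\Delta\otimes 1\otimes 1)\Phi\cdot(1\otimes 1\otimes\Delta)\Phi=(\Phi\otimes 1)\cdot(1\otimes\Delta\otimes 1)\Phi\cdot(1\otimes\Phi)$; $(\epsilon\otimes 1)\Delta=1=(1\otimes\epsilon)\Delta$; $(1\otimes\epsilon\otimes 1)\Phi=1$. Write $\Phi=\sum_\nu X_\nu\otimes Y_\nu\otimes Z_\nu$, $\Phi^{-1}=\sum_\nu\bar X_\nu\otimes\bar Y_\nu\otimes\bar Z_\nu$, $\Delta(a)=\sum a_{(1)}\otimes a_{(2)}$. A quasi-Hopf algebra $(H,\Delta,\epsilon,\Phi,S,\alpha,\beta)$ is a quasi-bialgebra with an algebra anti-homomorphism $S:H\to H$ (assumed bijective) and $\alpha,\beta\in H$ such that $\sum S(X_\nu)\alpha Y_\nu\beta S(Z_\nu)=1=\sum\bar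 X_\nu\beta S(\bar Y_\nu)\alpha\bar Z_\nu$ and $\sum S(a_{(1)})\alpha a_{(2)}=\epsilon(a)\alpha$, $\sum a_{(1)}\beta S(a_{(2)})=\epsilon(a)\beta$ for all $a\in H$. It is quasi-triangular if there is an invertible $\mathcal{R}=\sum e_i\otimes e^i\in H\otimes H$ (the $R$-matrix) with $\Delta^T(a)\mathcal{R}=\mathcal{R}\Delta(a)$ for all $a$, $(\Delta\otimes 1)\mathcal{R}=\Phi_{231}^{-1}\mathcal{R}_{13}\Phi_{132}\mathcal{R}_{23}\Phi_{123}^{-1}$, $(1\otimes\Delta)\mathcal{R}=\Phi_{312}\mathcal{R}_{13}\Phi_{213}^{-1}\mathcal{R}_{12}\Phi_{123}$. Here $\Delta^T=T\circ\Delta$ and $\mathcal{R}^T=T(\mathcal{R})$ with $T$ the flip, $\mathcal{R}_{12}=\sum e_i\otimes e^i\otimes 1$, $\mathcal{R}_{13}=\sum e_i\otimes 1\otimes e^i$, $\mathcal{R}_{23}=\sum 1\otimes e_i\otimes e^i$, and $\Phi_{123}=\Phi$, $\Phi_{132}=\sum X_\nu\otimes Z_\nu\otimes Y_\nu$, $\Phi_{213}=\sum Y_\nu\otimes X_\nu\otimes Z_\nu$, $\Phi_{231}=\sum Y_\nu\otimes Z_\nu\otimes X_\nu$, $\Phi_{312}=\sum Z_\nu\otimes X_\nu\otimes Y_\nu$. A twist is an invertible $F\in H\otimes H$ with $(\epsilon\otimes 1)F=(1\otimes\epsilon)F=1$. A twist $C\in H\otimes H$ is called compatible if (i) $C\Delta(a)=\Delta(a)C$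 for all $a\in H$, and (ii) $C$ satisfies the quasi-cocycle condition $(C\otimes 1)\cdot(\Delta\otimes 1)C\cdot\Phi=\Phi\cdot(1\otimes C)\cdot(1\otimes\Delta)C$. *)

theory Defs
  imports Complex_Main "HOL-Algebra.Module" "HOL-Library.Poly_Mapping"
begin

section \<open>Tensor powers of an algebra over a field\<close>

text \<open>
  The ground field is a type \<open>'k\<close>, the algebra a type \<open>'h\<close> with scalar multiplication
  \<open>scale\<close>. (That \<open>0 \<noteq> 1\<close> in \<open>'h\<close> is no restriction: an algebra with a unital
  homomorphism to a field is nonzero.) The \<open>n\<close>-th tensor power is the quotient of the vector
  space freely spanned by the words \<open>[a\<^sub>1, \<dots>, a\<^sub>n]\<close> by the subspace spanned by the multilinearity
  relations. It depends on the term \<open>scale\<close>, so it is a carrier set of equivalence classes,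
  packaged with its algebra operations as a record of type \<open>module\<close>.
\<close>

locale k_algebra = vector_space scale
  for scale :: "'k::field \<Rightarrow> 'h::ring_1 \<Rightarrow> 'h" +
  assumes scale_mult_left: "scale c a * b = scale c (a * b)"
    and scale_mult_right: "a * scale c b = scale c (a * b)"

type_synonym ('h, 'k) tensor = "('h list \<Rightarrow>\<^sub>0 'k) set"

definition free_words :: "nat \<Rightarrow> ('h list \<Rightarrow>\<^sub>0 'k::field) set" where
  "free_words n = {x. \<forall>u \<in> Poly_Mapping.keys x. length u = n}"

definition free_scale :: "'k::field \<Rightarrow> ('h list \<Rightarrow>\<^sub>0 'k) \<Rightarrow> ('h list \<Rightarrow>\<^sub>0 'k)" where
  "free_scale c x = Poly_Mapping.map ((*) c) x"

definition multilinear_relations ::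
  "('k::field \<Rightarrow> 'h::ring_1 \<Rightarrow> 'h) \<Rightarrow> nat \<Rightarrow> ('h list \<Rightarrow>\<^sub>0 'k) set" where
  "multilinear_relations scale n =
     {Poly_Mapping.single (us @ (a + b) # vs) 1
        - Poly_Mapping.single (us @ a # vs) 1 - Poly_Mapping.single (us @ b # vs) 1
      | us a b vs. length us + length vs + 1 = n}
   \<union> {Poly_Mapping.single (us @ scale c a # vs) 1 - Poly_Mapping.single (us @ a # vs) c
      | us c a vs. length us + length vs + 1 = n}"

definition tensor_rel ::
  "('k::field \<Rightarrow> 'h::ring_1 \<Rightarrow> 'h) \<Rightarrow> nat \<Rightarrow> (('h list \<Rightarrow>\<^sub>0 'k) \<times> ('h list \<Rightarrow>\<^sub>0 'k)) set" where
  "tensor_rel scale n =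
     {(x, y). x \<in> free_words n \<and> y \<in> free_words n
        \<and> x - y \<in> Modules.module.span free_scale (multilinear_relations scale n)}"

definition pure_tensor ::
  "('k::field \<Rightarrow> 'h::ring_1 \<Rightarrow> 'h) \<Rightarrow> 'h list \<Rightarrow> ('h, 'k) tensor" where
  "pure_tensor scale u = tensor_rel scale (length u) `` {Poly_Mapping.single u 1}"

text \<open>Factorwise product, extended bilinearly from words of equal length.\<close>

definition free_mult ::
  "('h::ring_1 list \<Rightarrow>\<^sub>0 'k::field) \<Rightarrow> ('h list \<Rightarrow>\<^sub>0 'k) \<Rightarrow> ('h list \<Rightarrow>\<^sub>0 'k)" where
  "free_mult x y = (\<Sum>u \<in> Poly_Mapping.keys x. \<Sum>v \<in> Poly_Mapping.keys y.
     Poly_Mapping.single (map2 (*) u v) (Poly_Mapping.lookup x u * Poly_Mapping.lookup y v))"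

definition tensor_power ::
  "('k::field \<Rightarrow> 'h::ring_1 \<Rightarrow> 'h) \<Rightarrow> nat \<Rightarrow> ('k, ('h, 'k) tensor) module" where
  "tensor_power scale n =
     \<lparr>carrier = free_words n // tensor_rel scale n,
      mult = (\<lambda>A B. \<Union>x\<in>A. \<Union>y\<in>B. tensor_rel scale n `` {free_mult x y}),
      one = pure_tensor scale (replicate n 1),
      zero = tensor_rel scale n `` {0},
      add = (\<lambda>A B. \<Union>x\<in>A. \<Union>y\<in>B. tensor_rel scale n `` {x + y}),
      smult = (\<lambda>c A. \<Union>x\<in>A. tensor_rel scale n `` {free_scale c x})\<rparr>"

text \<open>
  The linear maps induced by a function \<open>f\<close> on words that is multilinear in the letters:
  \<open>tensor_lift\<close> has values in the \<open>n\<close>-th tensor power, \<open>tensor_contract\<close> in the algebra itself.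
  Both evaluate a representative \<open>\<Sum>\<^sub>u c\<^sub>u u\<close> as \<open>\<Sum>\<^sub>u c\<^sub>u f(u)\<close>; for multilinear \<open>f\<close>
  the value does not depend on the representative.
\<close>

definition tensor_lift ::
  "('k::field \<Rightarrow> 'h::ring_1 \<Rightarrow> 'h) \<Rightarrow> nat \<Rightarrow> ('h list \<Rightarrow> ('h, 'k) tensor)
     \<Rightarrow> ('h, 'k) tensor \<Rightarrow> ('h, 'k) tensor" where
  "tensor_lift scale n f A = the_elem
     ((\<lambda>x. \<Oplus>\<^bsub>tensor_power scale n\<^esub>u \<in> Poly_Mapping.keys x.
        Poly_Mapping.lookup x u \<odot>\<^bsub>tensor_power scale n\<^esub> f u) ` A)"

definition tensor_contract ::
  "('k::field \<Rightarrow> 'h::ring_1 \<Rightarrow> 'h) \<Rightarrow> ('h list \<Rightarrow> 'h) \<Rightarrow> ('h, 'k) tensor \<Rightarrow> 'h" where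
  "tensor_contract scale f A = the_elem
     ((\<lambda>x. \<Sum>u \<in> Poly_Mapping.keys x. scale (Poly_Mapping.lookup x u) (f u)) ` A)"

text \<open>
  Permuting tensor factors and inserting units: \<open>g\<close> sends a word to a word of length \<open>n\<close> made
  of its letters, each used once, and of \<open>1\<close>s.
\<close>

definition rearrange ::
  "('k::field \<Rightarrow> 'h::ring_1 \<Rightarrow> 'h) \<Rightarrow> nat \<Rightarrow> ('h list \<Rightarrow> 'h list)
     \<Rightarrow> ('h, 'k) tensor \<Rightarrow> ('h, 'k) tensor" where
  "rearrange scale n g = tensor_lift scale n (\<lambda>u. pure_tensor scale (g u))"

definition flip :: "('k::field \<Rightarrow> 'h::ring_1 \<Rightarrow> 'h) \<Rightarrow> ('h, 'k) tensor \<Rightarrow> ('h, 'k) tensor" where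
  "flip scale = rearrange scale 2 (\<lambda>u. [u!1, u!0])"

text \<open>
  \<open>apply_coprod scale \<Delta> n i\<close> is \<open>1 \<otimes> \<dots> \<otimes> \<Delta> \<otimes> \<dots> \<otimes> 1\<close> from the \<open>n\<close>-th to the \<open>(n+1)\<close>-st
  tensor power, with \<open>\<Delta>\<close> acting on factor number \<open>i\<close>, counted from \<open>0\<close>.
\<close>

definition apply_coprod ::
  "('k::field \<Rightarrow> 'h::ring_1 \<Rightarrow> 'h) \<Rightarrow> ('h \<Rightarrow> ('h, 'k) tensor) \<Rightarrow> nat \<Rightarrow> nat
     \<Rightarrow> ('h, 'k) tensor \<Rightarrow> ('h, 'k) tensor" where
  "apply_coprod scale \<Delta> n i = tensor_lift scale (n + 1)
     (\<lambda>u. rearrange scale (n + 1) (\<lambda>v. take i u @ v @ drop (i + 1) u) (\<Delta> (u ! i)))"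


section \<open>Quasi-bialgebras, quasi-Hopf algebras, quasi-triangularity\<close>

locale quasi_bialgebra = k_algebra scale
  for scale :: "'k::field \<Rightarrow> 'h::ring_1 \<Rightarrow> 'h" +
  fixes \<Delta> :: "'h \<Rightarrow> ('h, 'k) tensor"
    and \<epsilon> :: "'h \<Rightarrow> 'k"
    and \<Phi> :: "('h, 'k) tensor"
  assumes counit_linear: "Vector_Spaces.linear scale (*) \<epsilon>"
    and counit_mult: "\<epsilon> (a * b) = \<epsilon> a * \<epsilon> b"
    and counit_one: "\<epsilon> 1 = 1"
    and coprod_closed: "\<Delta> a \<in> carrier (tensor_power scale 2)"
    and coprod_add: "\<Delta> (a + b) = \<Delta> a \<oplus>\<^bsub>tensor_power scale 2\<^esub> \<Delta> b"
    and coprod_scale: "\<Delta> (scale c a) = c \<odot>\<^bsub>tensor_power scale 2\<^esub> \<Delta> a"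
    and coprod_mult: "\<Delta> (a * b) = \<Delta> a \<otimes>\<^bsub>tensor_power scale 2\<^esub> \<Delta> b"
    and coprod_one: "\<Delta> 1 = \<one>\<^bsub>tensor_power scale 2\<^esub>"
    and assoc_invertible: "\<Phi> \<in> Units (tensor_power scale 3)"
    and quasi_coassoc:
      "apply_coprod scale \<Delta> 2 1 (\<Delta> a) =
         inv\<^bsub>tensor_power scale 3\<^esub> \<Phi>
           \<otimes>\<^bsub>tensor_power scale 3\<^esub> apply_coprod scale \<Delta> 2 0 (\<Delta> a)
           \<otimes>\<^bsub>tensor_power scale 3\<^esub> \<Phi>"
    and pentagon:
      "apply_coprod scale \<Delta> 3 0 \<Phi> \<otimes>\<^bsub>tensor_power scale 4\<^esub> apply_coprod scale \<Delta> 3 2 \<Phi> =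
         rearrange scale 4 (\<lambda>u. [u!0, u!1, u!2, 1]) \<Phi>
           \<otimes>\<^bsub>tensor_power scale 4\<^esub> apply_coprod scale \<Delta> 3 1 \<Phi>
           \<otimes>\<^bsub>tensor_power scale 4\<^esub> rearrange scale 4 (\<lambda>u. [1, u!0, u!1, u!2]) \<Phi>"
    and counit_left: "tensor_contract scale (\<lambda>u. scale (\<epsilon> (u!0)) (u!1)) (\<Delta> a) = a"
    and counit_right: "tensor_contract scale (\<lambda>u. scale (\<epsilon> (u!1)) (u!0)) (\<Delta> a) = a"
    and assoc_counit:
      "tensor_lift scale 2
         (\<lambda>u. \<epsilon> (u!1) \<odot>\<^bsub>tensor_power scale 2\<^esub> pure_tensor scale [u!0, u!2]) \<Phi>
       = \<one>\<^bsub>tensor_power scale 2\<^esub>"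

locale quasi_Hopf_algebra = quasi_bialgebra scale \<Delta> \<epsilon> \<Phi>
  for scale :: "'k::field \<Rightarrow> 'h::ring_1 \<Rightarrow> 'h"
    and \<Delta> :: "'h \<Rightarrow> ('h, 'k) tensor"
    and \<epsilon> :: "'h \<Rightarrow> 'k"
    and \<Phi> :: "('h, 'k) tensor" +
  fixes S :: "'h \<Rightarrow> 'h"
    and \<alpha> \<beta> :: 'h
  assumes antipode_linear: "Vector_Spaces.linear scale scale S"
    and antipode_mult: "S (a * b) = S b * S a"
    and antipode_one: "S 1 = 1"
    and antipode_bij: "bij S"
    and antipode_assoc:
      "tensor_contract scale (\<lambda>u. S (u!0) * \<alpha> * u!1 * \<beta> * S (u!2)) \<Phi> = 1"
    and antipode_inv_assoc:
      "tensor_contract scale (\<lambda>u. u!0 * \<beta> * S (u!1) * \<alpha> * u!2)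
         (inv\<^bsub>tensor_power scale 3\<^esub> \<Phi>) = 1"
    and antipode_left:
      "tensor_contract scale (\<lambda>u. S (u!0) * \<alpha> * u!1) (\<Delta> a) = scale (\<epsilon> a) \<alpha>"
    and antipode_right:
      "tensor_contract scale (\<lambda>u. u!0 * \<beta> * S (u!1)) (\<Delta> a) = scale (\<epsilon> a) \<beta>"

locale quasi_triangular_quasi_Hopf_algebra = quasi_Hopf_algebra scale \<Delta> \<epsilon> \<Phi> S \<alpha> \<beta>
  for scale :: "'k::field \<Rightarrow> 'h::ring_1 \<Rightarrow> 'h"
    and \<Delta> :: "'h \<Rightarrow> ('h, 'k) tensor"
    and \<epsilon> :: "'h \<Rightarrow> 'k"
    and \<Phi> :: "('h, 'k) tensor"
    and S :: "'h \<Rightarrow> 'h"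
    and \<alpha> \<beta> :: 'h +
  fixes R :: "('h, 'k) tensor"
  assumes R_invertible: "R \<in> Units (tensor_power scale 2)"
    and R_intertwines:
      "flip scale (\<Delta> a) \<otimes>\<^bsub>tensor_power scale 2\<^esub> R = R \<otimes>\<^bsub>tensor_power scale 2\<^esub> \<Delta> a"
    and coprod_left_R:
      "apply_coprod scale \<Delta> 2 0 R =
         inv\<^bsub>tensor_power scale 3\<^esub> (rearrange scale 3 (\<lambda>u. [u!1, u!2, u!0]) \<Phi>)
           \<otimes>\<^bsub>tensor_power scale 3\<^esub> rearrange scale 3 (\<lambda>u. [u!0, 1, u!1]) R
           \<otimes>\<^bsub>tensor_power scale 3\<^esub> rearrange scale 3 (\<lambda>u. [u!0, u!2, u!1]) \<Phi>
           \<otimes>\<^bsub>tensor_power scale 3\<^esub> rearrange scale 3 (\<lambda>u. [1, u!0, u!1]) R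
           \<otimes>\<^bsub>tensor_power scale 3\<^esub> inv\<^bsub>tensor_power scale 3\<^esub> \<Phi>"
    and coprod_right_R:
      "apply_coprod scale \<Delta> 2 1 R =
         rearrange scale 3 (\<lambda>u. [u!2, u!0, u!1]) \<Phi>
           \<otimes>\<^bsub>tensor_power scale 3\<^esub> rearrange scale 3 (\<lambda>u. [u!0, 1, u!1]) R
           \<otimes>\<^bsub>tensor_power scale 3\<^esub>
               inv\<^bsub>tensor_power scale 3\<^esub> (rearrange scale 3 (\<lambda>u. [u!1, u!0, u!2]) \<Phi>)
           \<otimes>\<^bsub>tensor_power scale 3\<^esub> rearrange scale 3 (\<lambda>u. [u!0, u!1, 1]) R
           \<otimes>\<^bsub>tensor_power scale 3\<^esub> \<Phi>"


section \<open>Twists and compatible twists\<close>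

definition is_twist ::
  "('k::field \<Rightarrow> 'h::ring_1 \<Rightarrow> 'h) \<Rightarrow> ('h \<Rightarrow> 'k) \<Rightarrow> ('h, 'k) tensor \<Rightarrow> bool" where
  "is_twist scale \<epsilon> F \<longleftrightarrow>
     F \<in> Units (tensor_power scale 2)
     \<and> tensor_contract scale (\<lambda>u. scale (\<epsilon> (u!0)) (u!1)) F = 1
     \<and> tensor_contract scale (\<lambda>u. scale (\<epsilon> (u!1)) (u!0)) F = 1"

definition compatible_twist ::
  "('k::field \<Rightarrow> 'h::ring_1 \<Rightarrow> 'h) \<Rightarrow> ('h \<Rightarrow> ('h, 'k) tensor) \<Rightarrow> ('h \<Rightarrow> 'k)
     \<Rightarrow> ('h, 'k) tensor \<Rightarrow> ('h, 'k) tensor \<Rightarrow> bool" where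
  "compatible_twist scale \<Delta> \<epsilon> \<Phi> C \<longleftrightarrow>
     is_twist scale \<epsilon> C
     \<and> (\<forall>a. C \<otimes>\<^bsub>tensor_power scale 2\<^esub> \<Delta> a = \<Delta> a \<otimes>\<^bsub>tensor_power scale 2\<^esub> C)
     \<and> rearrange scale 3 (\<lambda>u. [u!0, u!1, 1]) C
           \<otimes>\<^bsub>tensor_power scale 3\<^esub> apply_coprod scale \<Delta> 2 0 C
           \<otimes>\<^bsub>tensor_power scale 3\<^esub> \<Phi>
       = \<Phi> \<otimes>\<^bsub>tensor_power scale 3\<^esub> rearrange scale 3 (\<lambda>u. [1, u!0, u!1]) C
           \<otimes>\<^bsub>tensor_power scale 3\<^esub> apply_coprod scale \<Delta> 2 1 C"

end

theory Submission
  imports Defs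
begin

text \<open>
  Write \<open>R\<^sub>2\<^sub>1\<close> for the flipped R-matrix and \<open>C = R\<^sub>2\<^sub>1 R\<close>. Applying the intertwining relation
  \<open>\<Delta>\<^sup>T(a) R = R \<Delta>(a)\<close> and its flip shows that \<open>C\<close> commutes with every \<open>\<Delta>(a)\<close>. Hence \<open>C\<^sub>1\<^sub>2\<close> commutes
  with the image of \<open>\<Delta> \<otimes> 1\<close> and \<open>C\<^sub>2\<^sub>3\<close> with that of \<open>1 \<otimes> \<Delta>\<close>, so that
  \<open>C \<mapsto> C\<^sub>1\<^sub>2 (\<Delta> \<otimes> 1)C\<close> and \<open>C \<mapsto> C\<^sub>2\<^sub>3 (1 \<otimes> \<Delta>)C\<close> are multiplicative on such elements. The cocycle
  condition says that the two values are conjugate by \<open>\<Phi>\<close>. Compatible twists are therefore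
  closed under products and inverses, and only \<open>C\<close> itself has to be treated
  (\<open>monodromy_compatible\<close>).

  For the cocycle condition of \<open>C\<close>, the relation \<open>R\<^sub>1\<^sub>2 (\<Delta> \<otimes> 1)x = \<tau>((\<Delta> \<otimes> 1)x) R\<^sub>1\<^sub>2\<close>, where \<open>\<tau>\<close>
  exchanges the first two factors (\<open>coprod_at_intertwine\<close>), rewrites the left-hand side as
  \<open>R\<^sub>2\<^sub>1 \<tau>((\<Delta> \<otimes> 1)C) R\<^sub>1\<^sub>2 \<Phi>\<close>. Permuting the two hexagon identities
  (\<open>coprod_at_flip\<close>) gives
  \<open>\<tau>((\<Delta> \<otimes> 1)C) = \<Phi>\<^sub>2\<^sub>1\<^sub>3 R\<^sub>3\<^sub>1 \<Phi>\<^sub>3\<^sub>1\<^sub>2\<^sup>-\<^sup>1 C\<^sub>2\<^sub>3 \<Phi>\<^sub>3\<^sub>1\<^sub>2 R\<^sub>1\<^sub>3 \<Phi>\<^sub>2\<^sub>1\<^sub>3\<^sup>-\<^sup>1\<close>.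
  With the outer factors \<open>R\<^sub>2\<^sub>1\<close> and \<open>R\<^sub>1\<^sub>2 \<Phi>\<close> the parts to the left and right of \<open>C\<^sub>2\<^sub>3\<close> are again
  hexagons, \<open>\<Phi> (1 \<otimes> \<Delta>)R\<^sub>2\<^sub>1\<close> and \<open>(1 \<otimes> \<Delta>)R\<close>; moving \<open>C\<^sub>2\<^sub>3\<close> to the left finishes the computation.

  The counit conditions come from applying \<open>\<epsilon>\<close> to a tensor factor. On the third factor of the
  pentagon it yields \<open>(1 \<otimes> 1 \<otimes> \<epsilon>)\<Phi> = 1\<close> (\<open>assoc_counit_third\<close>); on the second factor of one hexagon
  and the third of the other it then yields \<open>(\<epsilon> \<otimes> 1)R = 1\<close> and \<open>(1 \<otimes> \<epsilon>)R = 1\<close> (\<open>counit_R\<close>).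

  All identities between linear maps on tensor powers are checked on pure tensors
  (\<open>lin_map_eqI\<close>, \<open>lin_map_multI\<close>), after a multilinear function on words has been shown to
  descend to a linear map (\<open>lift_lin_map\<close>, \<open>lift_pure\<close>).
\<close>

section \<open>The free vector space on words\<close>

lemma lookup_free_scale [simp]:
  "Poly_Mapping.lookup (free_scale c x) u = c * Poly_Mapping.lookup x u"
  by (simp add: free_scale_def Poly_Mapping.map.rep_eq when_def)

interpretation free: vector_space "free_scale :: 'k::field \<Rightarrow> ('h list \<Rightarrow>\<^sub>0 'k) \<Rightarrow> _"
  by unfold_locales (auto intro!: poly_mapping_eqI simp: lookup_add algebra_simps)

lemma keys_free_scale_subset: "Poly_Mapping.keys (free_scale c x) \<subseteq> Poly_Mapping.keys x"
  by (auto simp: in_keys_iff)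

lemma free_scale_single: "free_scale c (Poly_Mapping.single u d) = Poly_Mapping.single u (c * d)"
  by (rule poly_mapping_eqI) (simp add: lookup_single when_def)

lemma subspace_free_words: "free.subspace (free_words n :: ('h list \<Rightarrow>\<^sub>0 'k::field) set)"
  unfolding free.subspace_def free_words_def
  using keys_add keys_free_scale_subset by fastforce

lemmas free_words_add = free.subspace_add [OF subspace_free_words]
  and free_words_scale = free.subspace_scale [OF subspace_free_words]
  and free_words_diff = free.subspace_diff [OF subspace_free_words]
  and free_words_neg = free.subspace_neg [OF subspace_free_words]
  and free_words_zero = free.subspace_0 [OF subspace_free_words]

lemma single_in_free_words [simp]: "length u = n \<Longrightarrow> Poly_Mapping.single u c \<in> free_words n"
  by (simp add: free_words_def)

lemma sum_words: "(\<Sum>u\<in>Poly_Mapping.keys x. Poly_Mapping.single u (Poly_Mapping.lookup x u)) = x"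
  by (rule poly_mapping_eqI)
    (simp add: lookup_sum lookup_single when_def in_keys_iff)

lemma free_words_induct [consumes 1, case_names zero add scale word]:
  fixes x :: "'h list \<Rightarrow>\<^sub>0 'k::field"
  assumes x: "x \<in> free_words n"
    and "P 0"
    and add: "\<And>x y. x \<in> free_words n \<Longrightarrow> y \<in> free_words n \<Longrightarrow> P x \<Longrightarrow> P y \<Longrightarrow> P (x + y)"
    and scale: "\<And>c x. x \<in> free_words n \<Longrightarrow> P x \<Longrightarrow> P (free_scale c x)"
    and word: "\<And>u. length u = n \<Longrightarrow> P (Poly_Mapping.single u 1)"
  shows "P x"
proof -
  have *: "length u = n \<Longrightarrow> P (Poly_Mapping.single u c)" for u c
    using scale [OF _ word, of u c] by (simp add: free_scale_single)
  have "(\<Sum>u\<in>U. Poly_Mapping.single u (Poly_Mapping.lookup x u)) \<in> free_words n \<and>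
    P (\<Sum>u\<in>U. Poly_Mapping.single u (Poly_Mapping.lookup x u))"
    if "finite U" "U \<subseteq> Poly_Mapping.keys x" for U
    using that
  proof (induct U)
    case empty
    then show ?case using \<open>P 0\<close> by (simp add: free_words_zero)
  next
    case (insert u U)
    then have "length u = n" using x by (auto simp: free_words_def)
    then show ?case using insert
      by (auto intro!: free_words_add add *)
  qed
  from this [OF _ subset_refl] show ?thesis by (simp add: sum_words)
qed

text \<open>
  Bilinearity compares sums over the supports of different elements; enlarging both index sets to
  a common one makes this termwise.
\<close>

lemma free_mult_supset:
  assumes "finite U" "Poly_Mapping.keys x \<subseteq> U" "finite V" "Poly_Mapping.keys y \<subseteq> V"
  shows "free_mult x y = (\<Sum>u\<in>U. \<Sum>v\<in>V.
     Poly_Mapping.single (map2 (*) u v) (Poly_Mapping.lookup x u * Poly_Mapping.lookup y v))"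
proof -
  have "free_mult x y = (\<Sum>u\<in>Poly_Mapping.keys x. \<Sum>v\<in>V.
     Poly_Mapping.single (map2 (*) u v) (Poly_Mapping.lookup x u * Poly_Mapping.lookup y v))"
    unfolding free_mult_def using assms
    by (intro sum.cong refl sum.mono_neutral_left) (auto simp: in_keys_iff)
  also have "\<dots> = (\<Sum>u\<in>U. \<Sum>v\<in>V.
     Poly_Mapping.single (map2 (*) u v) (Poly_Mapping.lookup x u * Poly_Mapping.lookup y v))"
    using assms by (intro sum.mono_neutral_left) (auto simp: in_keys_iff)
  finally show ?thesis .
qed

lemma free_mult_single:
  "free_mult (Poly_Mapping.single u c) (Poly_Mapping.single v d)
    = Poly_Mapping.single (map2 (*) u v) (c * d)"
  by (subst free_mult_supset [of "{u}" _ "{v}"]) auto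

lemma free_mult_add_left: "free_mult (x + x') y = free_mult x y + free_mult x' y"
proof -
  let ?U = "Poly_Mapping.keys x \<union> Poly_Mapping.keys x'"
  have "Poly_Mapping.keys (x + x') \<subseteq> ?U" by (rule keys_add)
  then show ?thesis
    by (simp add: free_mult_supset [where U = ?U and V = "Poly_Mapping.keys y"] lookup_add
        ring_distribs single_add sum.distrib)
qed

lemma free_mult_add_right: "free_mult x (y + y') = free_mult x y + free_mult x y'"
proof -
  let ?U = "Poly_Mapping.keys y \<union> Poly_Mapping.keys y'"
  have "Poly_Mapping.keys (y + y') \<subseteq> ?U" by (rule keys_add)
  then show ?thesis
    by (simp add: free_mult_supset [where V = ?U and U = "Poly_Mapping.keys x"] lookup_add
        ring_distribs single_add sum.distrib)
qed

lemma free_mult_scale_left: "free_mult (free_scale c x) y = free_scale c (free_mult x y)"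
  by (simp add: free_mult_supset [where U = "Poly_Mapping.keys x" and V = "Poly_Mapping.keys y"]
      keys_free_scale_subset free.scale_sum_right free_scale_single mult.assoc)

lemma free_mult_scale_right: "free_mult x (free_scale c y) = free_scale c (free_mult x y)"
  by (simp add: free_mult_supset [where U = "Poly_Mapping.keys x" and V = "Poly_Mapping.keys y"]
      keys_free_scale_subset free.scale_sum_right free_scale_single mult.left_commute)

lemma free_mult_zero [simp]: "free_mult 0 y = 0" "free_mult x 0 = 0"
  by (simp_all add: free_mult_def)

lemma free_mult_diff_left: "free_mult (x - x') y = free_mult x y - free_mult x' y"
  using free_mult_add_left [of "x - x'" x' y] by simp

lemma free_mult_diff_right: "free_mult x (y - y') = free_mult x y - free_mult x y'"
  using free_mult_add_right [of x "y - y'" y'] by simp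

lemmas free_mult_bilinear = free_mult_add_left free_mult_add_right free_mult_diff_left
  free_mult_diff_right free_mult_scale_left free_mult_scale_right

lemma free_mult_closed:
  "x \<in> free_words n \<Longrightarrow> y \<in> free_words n \<Longrightarrow> free_mult x y \<in> free_words n"
  unfolding free_mult_def
  by (intro free.subspace_sum [OF subspace_free_words] single_in_free_words)
    (auto simp: free_words_def)

lemma map2_mult_assoc:
  "map2 (*) (map2 (*) u v) w = map2 (*) u (map2 (*) v (w :: 'a::semigroup_mult list))"
  by (rule nth_equalityI) (auto simp: mult.assoc)

lemma free_mult_assoc:
  fixes x y z :: "'h::ring_1 list \<Rightarrow>\<^sub>0 'k::field"
  assumes x: "x \<in> free_words n" and y: "y \<in> free_words n" and z: "z \<in> free_words n"
  shows "free_mult (free_mult x y) z = free_mult x (free_mult y z)"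
  using x
proof (induct x rule: free_words_induct)
  case (word u)
  show ?case using y
  proof (induct y rule: free_words_induct)
    case (word v)
    show ?case using z
      by (induct z rule: free_words_induct)
        (auto simp: free_mult_bilinear free_mult_single map2_mult_assoc)
  qed (auto simp: free_mult_bilinear)
qed (auto simp: free_mult_bilinear)

lemma map2_mult_replicate [simp]:
  fixes u :: "'a::monoid_mult list"
  shows "length u = n \<Longrightarrow> map2 (*) (replicate n 1) u = u" "length u = n \<Longrightarrow> map2 (*) u (replicate n 1) = u"
  by (auto intro!: nth_equalityI)

lemma free_mult_one:
  fixes x :: "'h::ring_1 list \<Rightarrow>\<^sub>0 'k::field"
  assumes "x \<in> free_words n"
  shows "free_mult (Poly_Mapping.single (replicate n 1) 1) x = x"
    and "free_mult x (Poly_Mapping.single (replicate n 1) 1) = x"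
  using assms
  by (induct x rule: free_words_induct) (auto simp: free_mult_bilinear free_mult_single)


section \<open>Algebras as records\<close>

text \<open>
  A possibly noncommutative algebra whose scalars form a field type, so that the tensor powers and
  the algebra itself are instances.
\<close>

locale assoc_algebra = ring A for A :: "('k::field, 'a) module" (structure) +
  assumes smult_closed [simp, intro]: "x \<in> carrier A \<Longrightarrow> c \<odot> x \<in> carrier A"
    and smult_add_left: "x \<in> carrier A \<Longrightarrow> (c + d) \<odot> x = c \<odot> x \<oplus> d \<odot> x"
    and smult_add_right: "x \<in> carrier A \<Longrightarrow> y \<in> carrier A \<Longrightarrow> c \<odot> (x \<oplus> y) = c \<odot> x \<oplus> c \<odot> y"
    and smult_smult: "x \<in> carrier A \<Longrightarrow> c \<odot> (d \<odot> x) = (c * d) \<odot> x"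
    and smult_one: "x \<in> carrier A \<Longrightarrow> 1 \<odot> x = x"
    and smult_mult_left: "x \<in> carrier A \<Longrightarrow> y \<in> carrier A \<Longrightarrow> (c \<odot> x) \<otimes> y = c \<odot> (x \<otimes> y)"
    and smult_mult_right: "x \<in> carrier A \<Longrightarrow> y \<in> carrier A \<Longrightarrow> x \<otimes> (c \<odot> y) = c \<odot> (x \<otimes> y)"
begin

lemma smult_zero_left [simp]: "x \<in> carrier A \<Longrightarrow> 0 \<odot> x = \<zero>"
  using smult_add_left [of x 0 0] add.l_cancel_one [of "0 \<odot> x" "0 \<odot> x"] by simp

lemma smult_zero_right [simp]: "c \<odot> \<zero> = \<zero>"
  using smult_smult [of \<zero> c 0] by simp

lemma finsum_smult:
  "finite U \<Longrightarrow> f \<in> U \<rightarrow> carrier A \<Longrightarrow> c \<odot> (\<Oplus>u\<in>U. f u) = (\<Oplus>u\<in>U. c \<odot> f u)"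
  by (induct U rule: finite_induct) (auto simp: smult_add_right Pi_iff)

text \<open>
  The value at \<open>x\<close> of the linear extension of \<open>f\<close> from words to the free vector space.
\<close>

definition word_sum :: "('w \<Rightarrow> 'a) \<Rightarrow> ('w \<Rightarrow>\<^sub>0 'k) \<Rightarrow> 'a" where
  "word_sum f x = (\<Oplus>u\<in>Poly_Mapping.keys x. Poly_Mapping.lookup x u \<odot> f u)"

lemma word_sum_supset:
  assumes "finite U" "Poly_Mapping.keys x \<subseteq> U" "f \<in> U \<rightarrow> carrier A"
  shows "word_sum f x = (\<Oplus>u\<in>U. Poly_Mapping.lookup x u \<odot> f u)"
proof -
  have U: "U = Poly_Mapping.keys x \<union> (U - Poly_Mapping.keys x)" using assms by auto
  have "(\<Oplus>u\<in>U - Poly_Mapping.keys x. Poly_Mapping.lookup x u \<odot> f u) = \<zero>"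
    using assms(3) by (intro add.finprod_one_eqI) (auto simp: in_keys_iff Pi_iff)
  moreover have "(\<Oplus>u\<in>Poly_Mapping.keys x \<union> (U - Poly_Mapping.keys x). Poly_Mapping.lookup x u \<odot> f u)
     = (\<Oplus>u\<in>Poly_Mapping.keys x. Poly_Mapping.lookup x u \<odot> f u)
       \<oplus> (\<Oplus>u\<in>U - Poly_Mapping.keys x. Poly_Mapping.lookup x u \<odot> f u)"
    using assms by (intro finsum_Un_disjoint) (auto simp: Pi_iff)
  moreover have "(\<Oplus>u\<in>Poly_Mapping.keys x. Poly_Mapping.lookup x u \<odot> f u) \<in> carrier A"
    using assms by (intro finsum_closed) (auto simp: Pi_iff)
  ultimately show ?thesis
    by (subst U) (simp add: word_sum_def)
qed

end

definition lin_map :: "('k, 'a) module \<Rightarrow> ('k, 'b) module \<Rightarrow> ('a \<Rightarrow> 'b) \<Rightarrow> bool" where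
  "lin_map A B F \<longleftrightarrow> F \<in> carrier A \<rightarrow> carrier B
     \<and> (\<forall>x\<in>carrier A. \<forall>y\<in>carrier A. F (x \<oplus>\<^bsub>A\<^esub> y) = F x \<oplus>\<^bsub>B\<^esub> F y)
     \<and> (\<forall>c. \<forall>x\<in>carrier A. F (c \<odot>\<^bsub>A\<^esub> x) = c \<odot>\<^bsub>B\<^esub> F x)"

definition alg_map :: "('k, 'a) module \<Rightarrow> ('k, 'b) module \<Rightarrow> ('a \<Rightarrow> 'b) \<Rightarrow> bool" where
  "alg_map A B F \<longleftrightarrow> lin_map A B F \<and> F \<one>\<^bsub>A\<^esub> = \<one>\<^bsub>B\<^esub>
     \<and> (\<forall>x\<in>carrier A. \<forall>y\<in>carrier A. F (x \<otimes>\<^bsub>A\<^esub> y) = F x \<otimes>\<^bsub>B\<^esub> F y)"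

lemma lin_mapD:
  assumes "lin_map A B F"
  shows "x \<in> carrier A \<Longrightarrow> F x \<in> carrier B"
    and "x \<in> carrier A \<Longrightarrow> y \<in> carrier A \<Longrightarrow> F (x \<oplus>\<^bsub>A\<^esub> y) = F x \<oplus>\<^bsub>B\<^esub> F y"
    and "x \<in> carrier A \<Longrightarrow> F (c \<odot>\<^bsub>A\<^esub> x) = c \<odot>\<^bsub>B\<^esub> F x"
  using assms by (auto simp: lin_map_def)

lemma lin_map_comp: "lin_map A B F \<Longrightarrow> lin_map B C G \<Longrightarrow> lin_map A C (\<lambda>x. G (F x))"
  by (auto simp: lin_map_def Pi_iff)

lemma lin_map_id: "lin_map A A (\<lambda>x. x)"
  by (auto simp: lin_map_def)

lemma alg_map_lin: "alg_map A B F \<Longrightarrow> lin_map A B F"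
  by (simp add: alg_map_def)

lemma alg_mapD:
  assumes "alg_map A B F"
  shows "x \<in> carrier A \<Longrightarrow> F x \<in> carrier B"
    and "x \<in> carrier A \<Longrightarrow> y \<in> carrier A \<Longrightarrow> F (x \<otimes>\<^bsub>A\<^esub> y) = F x \<otimes>\<^bsub>B\<^esub> F y"
    and "F \<one>\<^bsub>A\<^esub> = \<one>\<^bsub>B\<^esub>"
  using assms by (auto simp: alg_map_def lin_mapD)

lemma alg_map_unit:
  assumes F: "alg_map A B F" and "assoc_algebra A" "assoc_algebra B" and x: "x \<in> Units A"
  shows "F x \<in> Units B" and "F (inv\<^bsub>A\<^esub> x) = inv\<^bsub>B\<^esub> F x"
proof -
  interpret A: assoc_algebra A by fact
  interpret B: assoc_algebra B by fact
  have *: "F x \<otimes>\<^bsub>B\<^esub> F (inv\<^bsub>A\<^esub> x) = \<one>\<^bsub>B\<^esub>" "F (inv\<^bsub>A\<^esub> x) \<otimes>\<^bsub>B\<^esub> F x = \<one>\<^bsub>B\<^esub>"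
    using x alg_mapD(3) [OF F] by (simp_all add: alg_mapD(2) [OF F, symmetric] A.Units_closed)
  have c: "F x \<in> carrier B" "F (inv\<^bsub>A\<^esub> x) \<in> carrier B"
    using x by (auto intro!: alg_mapD(1) [OF F])
  show u: "F x \<in> Units B" using * c by (auto simp: Units_def)
  show "F (inv\<^bsub>A\<^esub> x) = inv\<^bsub>B\<^esub> F x"
    using B.inv_unique' [OF c *] by simp
qed


lemma (in monoid) unit_absorb:
  assumes "x \<in> Units G" "y \<in> carrier G"
  shows "y \<otimes> x = x \<Longrightarrow> y = \<one>" and "x \<otimes> y = x \<Longrightarrow> y = \<one>"
proof -
  assume "y \<otimes> x = x"
  then have "(y \<otimes> x) \<otimes> inv x = x \<otimes> inv x" by simp
  then show "y = \<one>" using assms by (simp add: m_assoc Units_closed)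
next
  assume "x \<otimes> y = x"
  then have "inv x \<otimes> (x \<otimes> y) = inv x \<otimes> x" by simp
  then show "y = \<one>" using assms by (simp add: m_assoc [symmetric] Units_closed)
qed

lemma (in monoid) unit_cancel:
  assumes "x \<in> Units G" "y \<in> carrier G"
  shows "x \<otimes> (inv x \<otimes> y) = y" and "inv x \<otimes> (x \<otimes> y) = y"
  using assms by (simp_all add: m_assoc [symmetric] Units_closed)


section \<open>The tensor powers are algebras\<close>

context k_algebra
begin

text \<open>
  The tensor power is the quotient of the free space by \<open>null n\<close>.
\<close>

abbreviation null where "null n \<equiv> free.span (multilinear_relations scale n)"
abbreviation T where "T n \<equiv> tensor_power scale n"
abbreviation pure where "pure \<equiv> pure_tensor scale"

definition tclass :: "nat \<Rightarrow> ('h list \<Rightarrow>\<^sub>0 'k) \<Rightarrow> ('h, 'k) tensor" where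
  "tclass n x = tensor_rel scale n `` {x}"

lemma tensor_rel_iff:
  "(x, y) \<in> tensor_rel scale n \<longleftrightarrow> x \<in> free_words n \<and> y \<in> free_words n \<and> x - y \<in> null n"
  by (simp add: tensor_rel_def)

lemma equiv_tensor_rel: "equiv (free_words n) (tensor_rel scale n)"
proof (rule equivI)
  show "refl_on (free_words n) (tensor_rel scale n)"
    by (auto simp: refl_on_def tensor_rel_iff free.span_zero)
  show "sym (tensor_rel scale n)"
    by (auto simp: sym_def tensor_rel_iff) (metis free.span_neg minus_diff_eq)
  show "trans (tensor_rel scale n)"
  proof (rule transI)
    fix x y z assume "(x, y) \<in> tensor_rel scale n" "(y, z) \<in> tensor_rel scale n"
    then show "(x, z) \<in> tensor_rel scale n"
      using free.span_add [of "x - y" "multilinear_relations scale n" "y - z"] by (simp add: tensor_rel_iff)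
  qed
qed (auto simp: tensor_rel_iff)

text \<open>
  Multiplying by a word only changes the letters next to the distinguished place of a relation and
  multiplies the letters at that place, which is again a relation of the same kind. Hence \<open>null n\<close> is
  a two-sided ideal and the product descends to the quotient.
\<close>

lemma relations_mult:
  assumes r: "r \<in> multilinear_relations scale n" and w: "length w = n"
  shows "free_mult (Poly_Mapping.single w 1) r \<in> multilinear_relations scale n"
    and "free_mult r (Poly_Mapping.single w 1) \<in> multilinear_relations scale n"
proof -
  have split: "\<exists>ws d zs. w = ws @ d # zs \<and> length ws = length us \<and> length zs = length vs"
    if "length us + length vs + 1 = n" for us vs :: "'h list"
    using that w id_take_nth_drop [of "length us" w]
    by (intro exI [of _ "take (length us) w"] exI [of _ "w ! length us"] exI [of _ "drop (Suc (length us)) w"]) auto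
  consider us a b vs where "length us + length vs + 1 = n"
      "r = Poly_Mapping.single (us @ (a + b) # vs) 1
        - Poly_Mapping.single (us @ a # vs) 1 - Poly_Mapping.single (us @ b # vs) 1"
    | us c a vs where "length us + length vs + 1 = n"
      "r = Poly_Mapping.single (us @ scale c a # vs) 1 - Poly_Mapping.single (us @ a # vs) c"
    using r by (auto simp: multilinear_relations_def)
  then have "free_mult (Poly_Mapping.single w 1) r \<in> multilinear_relations scale n \<and>
     free_mult r (Poly_Mapping.single w 1) \<in> multilinear_relations scale n"
  proof cases
    case 1
    from split [OF 1(1)] obtain ws d zs where "w = ws @ d # zs" "length ws = length us" "length zs = length vs"
      by blast
    then show ?thesis using 1
      by (auto simp: free_mult_bilinear free_mult_single distrib_left distrib_right multilinear_relations_def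
        intro!: disjI1) (metis length_map length_zip min.idem)+
  next
    case 2
    from split [OF 2(1)] obtain ws d zs where "w = ws @ d # zs" "length ws = length us" "length zs = length vs"
      by blast
    then show ?thesis using 2
      by (auto simp: free_mult_bilinear free_mult_single scale_mult_left scale_mult_right multilinear_relations_def
        intro!: disjI2) (metis length_map length_zip min.idem)+
  qed
  then show "free_mult (Poly_Mapping.single w 1) r \<in> multilinear_relations scale n"
    and "free_mult r (Poly_Mapping.single w 1) \<in> multilinear_relations scale n" by auto
qed

lemma null_mult:
  assumes x: "x \<in> free_words n" and y: "y \<in> null n"
  shows "free_mult x y \<in> null n" "free_mult y x \<in> null n"
proof -
  have "free_mult x y \<in> null n \<and> free_mult y x \<in> null n"
    using y
  proof (induct y rule: free.span_induct_alt)
    case base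
    then show ?case by (simp add: free.span_zero)
  next
    case (step c r y)
    have "free_mult x r \<in> null n \<and> free_mult r x \<in> null n"
      using x
    proof (induct x rule: free_words_induct)
      case (word u)
      then show ?case using relations_mult [OF step(1)] by (auto intro: free.span_base)
    qed (auto simp: free_mult_bilinear free.span_zero free.span_add free.span_scale)
    then show ?case using step by (auto simp: free_mult_bilinear free.span_add free.span_scale)
  qed
  then show "free_mult x y \<in> null n" "free_mult y x \<in> null n" by auto
qed

lemma tclass_eq_iff: "x \<in> free_words n \<Longrightarrow> y \<in> free_words n \<Longrightarrow> tclass n x = tclass n y \<longleftrightarrow> x - y \<in> null n"
  unfolding tclass_def using eq_equiv_class_iff [OF equiv_tensor_rel, of x n y] by (simp add: tensor_rel_iff)

lemma carrier_T: "carrier (T n) = tclass n ` free_words n"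
  by (auto simp: tensor_power_def quotient_def tclass_def)

lemma tclass_closed [simp, intro]: "x \<in> free_words n \<Longrightarrow> tclass n x \<in> carrier (T n)"
  by (simp add: carrier_T)

lemma tensor_cases:
  assumes "A \<in> carrier (T n)" obtains x where "x \<in> free_words n" "A = tclass n x"
  using assms by (auto simp: carrier_T)

lemma tclass_add:
  assumes "x \<in> free_words n" "y \<in> free_words n"
  shows "tclass n x \<oplus>\<^bsub>T n\<^esub> tclass n y = tclass n (x + y)"
proof -
  have "congruent2 (tensor_rel scale n) (tensor_rel scale n) (\<lambda>x y. tensor_rel scale n `` {x + y})"
    by (intro congruent2I' equiv_class_eq [OF equiv_tensor_rel])
       (auto simp: tensor_rel_iff free_words_add add_diff_add intro: free.span_add)
  from UN_equiv_class2 [OF equiv_tensor_rel equiv_tensor_rel this assms]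
  show ?thesis by (simp add: tensor_power_def tclass_def)
qed

lemma tclass_mult:
  assumes "x \<in> free_words n" "y \<in> free_words n"
  shows "tclass n x \<otimes>\<^bsub>T n\<^esub> tclass n y = tclass n (free_mult x y)"
proof -
  have "congruent2 (tensor_rel scale n) (tensor_rel scale n) (\<lambda>x y. tensor_rel scale n `` {free_mult x y})"
  proof (intro congruent2I' equiv_class_eq [OF equiv_tensor_rel])
    fix x x' y y' assume *: "(x, x') \<in> tensor_rel scale n" "(y, y') \<in> tensor_rel scale n"
    have "free_mult x y - free_mult x' y' = free_mult (x - x') y + free_mult x' (y - y')"
      by (simp add: free_mult_bilinear)
    then show "(free_mult x y, free_mult x' y') \<in> tensor_rel scale n"
      using * null_mult(2) [of y n "x - x'"] null_mult(1) [of x' n "y - y'"]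
      by (auto simp: tensor_rel_iff free_mult_closed intro: free.span_add)
  qed
  from UN_equiv_class2 [OF equiv_tensor_rel equiv_tensor_rel this assms]
  show ?thesis by (simp add: tensor_power_def tclass_def)
qed

lemma tclass_scale:
  assumes "x \<in> free_words n"
  shows "c \<odot>\<^bsub>T n\<^esub> tclass n x = tclass n (free_scale c x)"
proof -
  have "(\<lambda>x. tensor_rel scale n `` {free_scale c x}) respects (tensor_rel scale n)"
    by (intro congruentI equiv_class_eq [OF equiv_tensor_rel])
       (auto simp: tensor_rel_iff free_words_scale free.scale_right_diff_distrib [symmetric] intro: free.span_scale)
  from UN_equiv_class [OF equiv_tensor_rel this assms]
  show ?thesis by (simp add: tensor_power_def tclass_def)
qed

lemma T_zero: "\<zero>\<^bsub>T n\<^esub> = tclass n 0"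
  by (simp add: tensor_power_def tclass_def)

lemma T_one: "\<one>\<^bsub>T n\<^esub> = pure (replicate n 1)"
  by (simp add: tensor_power_def)

lemma pure_tclass: "length u = n \<Longrightarrow> pure u = tclass n (Poly_Mapping.single u 1)"
  by (auto simp: pure_tensor_def tclass_def)

lemmas tclass_simps = tclass_add tclass_mult tclass_scale T_zero T_one pure_tclass free_words_add free_words_scale
  free_words_zero free_mult_closed

lemma assoc_algebra_T: "assoc_algebra (T n)"
proof -
  have inv: "\<exists>B\<in>carrier (T n). B \<oplus>\<^bsub>T n\<^esub> A = \<zero>\<^bsub>T n\<^esub>" if "A \<in> carrier (T n)" for A
  proof -
    from that obtain x where "x \<in> free_words n" "A = tclass n x" by (rule tensor_cases)
    then show ?thesis
      by (intro bexI [of _ "tclass n (- x)"]) (simp_all add: tclass_simps free_words_neg)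
  qed
  have "ring (T n)"
    by (intro ringI abelian_groupI monoidI; (rule inv, assumption)?)
      (auto elim!: tensor_cases simp: tclass_simps ac_simps free_mult_bilinear free_mult_assoc free_mult_one)
  then show ?thesis
    by (intro assoc_algebra.intro assoc_algebra_axioms.intro)
      (auto elim!: tensor_cases simp: tclass_simps free_mult_bilinear
        free.scale_left_distrib free.scale_right_distrib)
qed

lemma T_algebra [simp]: "assoc_algebra (T n)" "monoid (T n)"
  using assoc_algebra_T [of n] by (auto simp: assoc_algebra_def ring_def)

text \<open>
  The algebra itself as a record: with it, \<open>tensor_contract\<close> becomes the same construction as
  \<open>tensor_lift\<close>, with another target.
\<close>

definition regular :: "('k, 'h) module" where
  "regular = \<lparr>carrier = UNIV, mult = (*), one = 1, zero = 0, add = (+), smult = scale\<rparr>"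

lemma regular_simps [simp]:
  "carrier regular = UNIV" "mult regular = (*)" "one regular = 1" "zero regular = 0"
  "add regular = (+)" "smult regular = scale"
  by (simp_all add: regular_def)

lemma regular_algebra: "assoc_algebra regular"
proof -
  have "\<exists>y. y + x = 0" for x :: 'h by (rule exI [of _ "- x"]) simp
  then have "ring regular"
    by (intro ringI abelian_groupI monoidI) (auto simp: algebra_simps)
  then show ?thesis
    by (intro assoc_algebra.intro assoc_algebra_axioms.intro)
      (auto simp: scale_left_distrib scale_right_distrib scale_mult_left scale_mult_right)
qed


section \<open>Linear maps out of a tensor power\<close>

text \<open>
  Letters are varied by list update, since rearrangements of words commute with updates.
\<close>

definition multilin :: "('k, 'm) module \<Rightarrow> nat \<Rightarrow> ('h list \<Rightarrow> 'm) \<Rightarrow> bool" where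
  "multilin M n f \<longleftrightarrow> (\<forall>u. length u = n \<longrightarrow> f u \<in> carrier M)
     \<and> (\<forall>u i a b. length u = n \<longrightarrow> i < n \<longrightarrow> f (u[i := a + b]) = f (u[i := a]) \<oplus>\<^bsub>M\<^esub> f (u[i := b]))
     \<and> (\<forall>u i c a. length u = n \<longrightarrow> i < n \<longrightarrow> f (u[i := scale c a]) = c \<odot>\<^bsub>M\<^esub> f (u[i := a]))"

definition lift :: "('k, 'm) module \<Rightarrow> ('h list \<Rightarrow> 'm) \<Rightarrow> ('h, 'k) tensor \<Rightarrow> 'm" where
  "lift M f A = the_elem
     ((\<lambda>x. \<Oplus>\<^bsub>M\<^esub>u \<in> Poly_Mapping.keys x. Poly_Mapping.lookup x u \<odot>\<^bsub>M\<^esub> f u) ` A)"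

lemma tensor_lift_eq: "tensor_lift scale n f = lift (T n) f"
  by (simp add: tensor_lift_def lift_def fun_eq_iff)

lemma tensor_contract_eq: "tensor_contract scale f = lift regular f"
proof -
  interpret R: assoc_algebra regular by (rule regular_algebra)
  have "(\<Oplus>\<^bsub>regular\<^esub>u\<in>U. g u) = (\<Sum>u\<in>U. g u)" if "finite U" for U and g :: "'h list \<Rightarrow> 'h"
    using that by (induct U) auto
  then show ?thesis by (simp add: tensor_contract_def lift_def fun_eq_iff)
qed

text \<open>
  The universal property of the tensor power. The linear extension of \<open>f\<close> vanishes on the generating
  relations by multilinearity, hence on \<open>null n\<close>, so that it is constant on each class.
\<close>

lemma
  assumes M: "assoc_algebra M" and f: "multilin M n f"
  shows lift_lin_map: "lin_map (T n) M (lift M f)"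
    and lift_pure: "\<And>u. length u = n \<Longrightarrow> lift M f (pure u) = f u"
proof -
  interpret M: assoc_algebra M by (rule M)
  have fc [simp]: "length u = n \<Longrightarrow> f u \<in> carrier M" for u using f by (simp add: multilin_def)
  have keys: "f \<in> Poly_Mapping.keys x \<rightarrow> carrier M" if "x \<in> free_words n" for x :: "'h list \<Rightarrow>\<^sub>0 'k"
    using that by (auto simp: free_words_def)
  have ws_closed: "M.word_sum f x \<in> carrier M" if "x \<in> free_words n" for x
    using keys [OF that] unfolding M.word_sum_def by (intro M.finsum_closed) (auto simp: Pi_iff)
  have ws_add: "M.word_sum f (x + y) = M.word_sum f x \<oplus>\<^bsub>M\<^esub> M.word_sum f y"
    if x: "x \<in> free_words n" and y: "y \<in> free_words n" for x y
  proof -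
    let ?U = "Poly_Mapping.keys x \<union> Poly_Mapping.keys y"
    have U: "f \<in> ?U \<rightarrow> carrier M" using keys [OF x] keys [OF y] by auto
    then have "M.word_sum f (x + y)
      = (\<Oplus>\<^bsub>M\<^esub>u\<in>?U. Poly_Mapping.lookup x u \<odot>\<^bsub>M\<^esub> f u \<oplus>\<^bsub>M\<^esub> Poly_Mapping.lookup y u \<odot>\<^bsub>M\<^esub> f u)"
      unfolding M.word_sum_supset [OF _ keys_add U, simplified]
      by (intro M.finsum_cong') (auto simp: lookup_add M.smult_add_left Pi_iff)
    also have "\<dots> = M.word_sum f x \<oplus>\<^bsub>M\<^esub> M.word_sum f y"
      using U by (subst M.finsum_addf) (auto simp: Pi_iff M.word_sum_supset [of ?U])
    finally show ?thesis .
  qed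
  have ws_scale: "M.word_sum f (free_scale c x) = c \<odot>\<^bsub>M\<^esub> M.word_sum f x"
    if x: "x \<in> free_words n" for c x
  proof -
    have "M.word_sum f (free_scale c x)
      = (\<Oplus>\<^bsub>M\<^esub>u\<in>Poly_Mapping.keys x. c \<odot>\<^bsub>M\<^esub> (Poly_Mapping.lookup x u \<odot>\<^bsub>M\<^esub> f u))"
      using keys [OF x] keys_free_scale_subset [of c x]
      by (subst M.word_sum_supset [of "Poly_Mapping.keys x"]) (auto simp: M.smult_smult Pi_iff intro!: M.finsum_cong')
    then show ?thesis
      using keys [OF x] by (simp add: M.word_sum_def M.finsum_smult Pi_iff)
  qed
  have ws_single: "M.word_sum f (Poly_Mapping.single u c) = c \<odot>\<^bsub>M\<^esub> f u" if "length u = n" for u c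
    using that by (subst M.word_sum_supset [of "{u}"]) auto
  have ws_diff: "M.word_sum f (x - y) = M.word_sum f x \<ominus>\<^bsub>M\<^esub> M.word_sum f y"
    if "x \<in> free_words n" "y \<in> free_words n" for x y
    using ws_add [of "x - y" y] ws_closed that free_words_diff [OF that]
    by (simp add: M.minus_eq M.a_assoc M.r_neg)
  have upd: "us @ a # vs = (us @ 0 # vs)[length us := a]" for us vs and a :: 'h
    by simp
  have relation: "r \<in> free_words n \<and> M.word_sum f r = \<zero>\<^bsub>M\<^esub>" if "r \<in> multilinear_relations scale n" for r
    using that unfolding multilinear_relations_def
  proof (elim UnE CollectE exE conjE)
    fix us a b vs assume l: "length us + length vs + 1 = n"
      and r: "r = Poly_Mapping.single (us @ (a + b) # vs) 1
        - Poly_Mapping.single (us @ a # vs) 1 - Poly_Mapping.single (us @ b # vs) 1"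
    have "f (us @ (a + b) # vs) = f (us @ a # vs) \<oplus>\<^bsub>M\<^esub> f (us @ b # vs)"
      unfolding upd [of us "a + b"] upd [of us a] upd [of us b]
      using f l by (simp add: multilin_def del: list_update_length)
    moreover have "p \<oplus>\<^bsub>M\<^esub> q \<ominus>\<^bsub>M\<^esub> p = q" if "p \<in> carrier M" "q \<in> carrier M" for p q
      using that by (simp add: M.a_comm [of p q] M.a_assoc M.minus_eq M.r_neg)
    ultimately show ?thesis unfolding r using l
      by (simp add: ws_diff ws_single free_words_diff M.smult_one) (simp add: M.minus_eq M.r_neg)
  next
    fix us c a vs assume l: "length us + length vs + 1 = n"
      and r: "r = Poly_Mapping.single (us @ scale c a # vs) 1 - Poly_Mapping.single (us @ a # vs) c"
    have "f (us @ scale c a # vs) = c \<odot>\<^bsub>M\<^esub> f (us @ a # vs)"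
      unfolding upd [of us "scale c a"] upd [of us a]
      using f l by (simp add: multilin_def del: list_update_length)
    then show ?thesis unfolding r using l
      by (simp add: ws_diff ws_single free_words_diff M.smult_one M.minus_eq M.r_neg)
  qed
  have ws_null: "x \<in> free_words n \<and> M.word_sum f x = \<zero>\<^bsub>M\<^esub>" if "x \<in> null n" for x
    using that
  proof (induct x rule: free.span_induct_alt)
    case base
    then show ?case by (simp add: free_words_zero M.word_sum_def)
  next
    case (step c r y)
    then show ?case using relation [of r]
      by (simp add: free_words_add free_words_scale ws_add ws_scale)
  qed
  have lift_tclass: "lift M f (tclass n x) = M.word_sum f x" if x: "x \<in> free_words n" for x
    unfolding lift_def M.word_sum_def [symmetric]
  proof (rule the_elem_image_unique)
    show "tclass n x \<noteq> {}" using x equiv_class_self [OF equiv_tensor_rel x] by (auto simp: tclass_def)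
    fix y assume "y \<in> tclass n x"
    then have y: "y \<in> free_words n" and "x - y \<in> null n" by (auto simp: tclass_def tensor_rel_iff)
    then have "M.word_sum f ((x - y) + y) = M.word_sum f y"
      using ws_null [of "x - y"] ws_add [of "x - y" y] ws_closed [OF y] by simp
    then show "M.word_sum f y = M.word_sum f x" by simp
  qed
  show "lin_map (T n) M (lift M f)"
    unfolding lin_map_def
    by (auto elim!: tensor_cases simp: tclass_add tclass_scale lift_tclass ws_closed ws_add ws_scale free_words_add free_words_scale)
  show "lift M f (pure u) = f u" if "length u = n" for u
    using that by (simp add: pure_tclass lift_tclass ws_single M.smult_one)
qed

lemma pure_multilin: "multilin (T n) n pure"
proof -
  have *: "u[i := x] = take i u @ x # drop (Suc i) u" "length (take i u) + length (drop (Suc i) u) + 1 = n"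
    if "length u = n" "i < n" for u i and x :: 'h
    using that by (auto simp: upd_conv_take_nth_drop)
  have "pure (u[i := a + b]) = pure (u[i := a]) \<oplus>\<^bsub>T n\<^esub> pure (u[i := b])"
    if l: "length u = n" "i < n" for u i a b
  proof -
    have "Poly_Mapping.single (u[i := a + b]) 1 - Poly_Mapping.single (u[i := a]) 1
       - Poly_Mapping.single (u[i := b]) (1 :: 'k) \<in> null n"
      unfolding *(1) [OF l] multilinear_relations_def
      by (rule free.span_base, rule UnI1) (use *(2) [OF l] in blast)
    then show ?thesis using l by (simp add: pure_tclass tclass_add tclass_eq_iff free_words_add diff_diff_eq)
  qed
  moreover have "pure (u[i := scale c a]) = c \<odot>\<^bsub>T n\<^esub> pure (u[i := a])"
    if l: "length u = n" "i < n" for u i a c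
  proof -
    have "Poly_Mapping.single (u[i := scale c a]) 1 - Poly_Mapping.single (u[i := a]) c \<in> null n"
      unfolding *(1) [OF l] multilinear_relations_def
      by (rule free.span_base, rule UnI2) (use *(2) [OF l] in blast)
    then show ?thesis using l by (simp add: pure_tclass tclass_scale free_scale_single tclass_eq_iff free_words_scale)
  qed
  ultimately show ?thesis by (simp add: multilin_def pure_tclass)
qed

lemma pure_closed [simp]: "length u = n \<Longrightarrow> pure u \<in> carrier (T n)"
  by (simp add: pure_tclass)

lemma pure_mult: "length u = n \<Longrightarrow> length v = n \<Longrightarrow> pure u \<otimes>\<^bsub>T n\<^esub> pure v = pure (map2 (*) u v)"
  by (simp add: pure_tclass tclass_mult free_mult_single)

lemma tensor_induct [consumes 1, case_names add scale pure]:
  assumes x: "x \<in> carrier (T n)"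
    and add: "\<And>x y. x \<in> carrier (T n) \<Longrightarrow> y \<in> carrier (T n) \<Longrightarrow> P x \<Longrightarrow> P y \<Longrightarrow> P (x \<oplus>\<^bsub>T n\<^esub> y)"
    and scale: "\<And>c x. x \<in> carrier (T n) \<Longrightarrow> P x \<Longrightarrow> P (c \<odot>\<^bsub>T n\<^esub> x)"
    and pure: "\<And>u. length u = n \<Longrightarrow> P (pure u)"
  shows "P x"
proof -
  from x obtain y where y: "y \<in> free_words n" and xy: "x = tclass n y" by (rule tensor_cases)
  have "P (tclass n y)" using y
  proof (induct y rule: free_words_induct)
    case zero
    have "P (0 \<odot>\<^bsub>T n\<^esub> pure (replicate n 0))" by (intro scale pure) auto
    moreover have "free_scale 0 (Poly_Mapping.single (replicate n 0) 1) = (0 :: 'h list \<Rightarrow>\<^sub>0 'k)"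
      by (simp add: free_scale_single)
    ultimately show ?case by (simp add: pure_tclass tclass_scale del: free.scale_zero_left)
  next
    case (add x y)
    then show ?case using assms(2) [of "tclass n x" "tclass n y"] by (simp add: tclass_add)
  next
    case (scale c x)
    then show ?case using assms(3) [of "tclass n x" c] by (simp add: tclass_scale)
  next
    case (word u)
    then show ?case using pure [of u] by (simp add: pure_tclass)
  qed
  then show ?thesis by (simp add: xy)
qed

lemma lin_map_eqI:
  assumes F: "lin_map (T n) M F" and G: "lin_map (T n) M G"
    and "\<And>u. length u = n \<Longrightarrow> F (pure u) = G (pure u)"
    and x: "x \<in> carrier (T n)"
  shows "F x = G x"
  using x by (induct x rule: tensor_induct) (simp_all add: lin_mapD [OF F] lin_mapD [OF G] assms)

text \<open>
  Stated for three maps, so that besides algebra homomorphisms it also covers \<open>insertion_mult\<close>,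
  where both factors and the product belong to different words.
\<close>

lemma lin_map_multI:
  assumes M: "assoc_algebra M" and F: "lin_map (T n) M F" and G: "lin_map (T n) M G" and K: "lin_map (T n) M K"
    and pure: "\<And>u v. length u = n \<Longrightarrow> length v = n \<Longrightarrow> K (pure (map2 (*) u v)) = F (pure u) \<otimes>\<^bsub>M\<^esub> G (pure v)"
    and x: "x \<in> carrier (T n)" and y: "y \<in> carrier (T n)"
  shows "K (x \<otimes>\<^bsub>T n\<^esub> y) = F x \<otimes>\<^bsub>M\<^esub> G y"
proof -
  interpret M: assoc_algebra M by (rule M)
  interpret T: assoc_algebra "T n" by simp
  note simps = lin_mapD [OF F] lin_mapD [OF G] lin_mapD [OF K] T.l_distr T.r_distr M.l_distr M.r_distr
    T.smult_mult_left T.smult_mult_right M.smult_mult_left M.smult_mult_right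
  show ?thesis using x
  proof (induct x rule: tensor_induct)
    case (pure u)
    show ?case using y
      by (induct y rule: tensor_induct) (simp_all add: simps pure pure_mult assms)
  qed (simp_all add: simps y)
qed

lemma alg_mapI:
  assumes "assoc_algebra M" "lin_map (T n) M F"
    and "\<And>u v. length u = n \<Longrightarrow> length v = n \<Longrightarrow> F (pure (map2 (*) u v)) = F (pure u) \<otimes>\<^bsub>M\<^esub> F (pure v)"
    and "F (pure (replicate n 1)) = \<one>\<^bsub>M\<^esub>"
  shows "alg_map (T n) M F"
  unfolding alg_map_def T_one
  by (intro conjI ballI assms lin_map_multI [OF assms(1,2,2,2,3)])


section \<open>Rearrangements\<close>

text \<open>
  Changing one letter of the argument changes at most one letter of the value, at a place that does
  not depend on the word, so composition with a multilinear function is multilinear. Words may also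
  acquire constant letters, such as inserted units.
\<close>

definition placement :: "nat \<Rightarrow> nat \<Rightarrow> ('h list \<Rightarrow> 'h list) \<Rightarrow> bool" where
  "placement n m g \<longleftrightarrow> (\<forall>u. length u = n \<longrightarrow> length (g u) = m)
     \<and> (\<forall>i<n. \<exists>j<m. \<forall>u a. length u = n \<longrightarrow> g (u[i := a]) = (g u)[j := a])"

definition unital_placement :: "nat \<Rightarrow> nat \<Rightarrow> ('h list \<Rightarrow> 'h list) \<Rightarrow> bool" where
  "unital_placement n m g \<longleftrightarrow> placement n m g \<and> g (replicate n 1) = replicate m 1
     \<and> (\<forall>u v. length u = n \<longrightarrow> length v = n \<longrightarrow> g (map2 (*) u v) = map2 (*) (g u) (g v))"

lemma placement_length: "placement n m g \<Longrightarrow> length u = n \<Longrightarrow> length (g u) = m"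
  by (simp add: placement_def)

lemma multilin_placement:
  assumes g: "placement n m g" and f: "multilin M m f"
  shows "multilin M n (\<lambda>u. f (g u))"
proof -
  have "f (g (u[i := a + b])) = f (g (u[i := a])) \<oplus>\<^bsub>M\<^esub> f (g (u[i := b])) \<and>
    f (g (u[i := scale c a])) = c \<odot>\<^bsub>M\<^esub> f (g (u[i := a]))" if "length u = n" "i < n" for u i a b c
  proof -
    from g that obtain j where "j < m" "\<And>a. g (u[i := a]) = (g u)[j := a]"
      unfolding placement_def by metis
    then show ?thesis using f that placement_length [OF g] by (auto simp: multilin_def)
  qed
  then show ?thesis using f placement_length [OF g] by (simp add: multilin_def)
qed

lemma rearrange_lin_map: "placement n m g \<Longrightarrow> lin_map (T n) (T m) (rearrange scale m g)"
  unfolding rearrange_def tensor_lift_eq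
  by (rule lift_lin_map [OF assoc_algebra_T multilin_placement [OF _ pure_multilin]])

lemma rearrange_pure:
  "placement n m g \<Longrightarrow> length u = n \<Longrightarrow> rearrange scale m g (pure u) = pure (g u)"
  unfolding rearrange_def tensor_lift_eq
  by (rule lift_pure [OF assoc_algebra_T multilin_placement [OF _ pure_multilin]])

lemma rearrange_alg_map:
  assumes "unital_placement n m g" shows "alg_map (T n) (T m) (rearrange scale m g)"
  using assms rearrange_pure [of n m g] placement_length [of n m g]
  by (intro alg_mapI) (auto simp: unital_placement_def rearrange_lin_map pure_mult T_one)

lemmas placement_simps = placement_def unital_placement_def numeral_eq_Suc
  All_less_Suc Ex_less_Suc length_Suc_conv

lemma placement_comp: "placement n m g \<Longrightarrow> placement m l h \<Longrightarrow> placement n l (\<lambda>u. h (g u))"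
  unfolding placement_def by metis

lemma unital_placement_placement: "unital_placement n m g \<Longrightarrow> placement n m g"
  by (simp add: unital_placement_def)

text \<open>
  The index \<open>1\<close> has to stay in the form in which the axioms of a quasi-bialgebra write it.
\<close>

declare One_nat_def [simp del]

text \<open>
  The flip, the unit insertions and the permutations needed below; the collections
  \<open>placements\<close>, \<open>rearrange_algs\<close>, \<open>rearrange_pures\<close> and \<open>rearrange_lins\<close> share this numbering.
\<close>

lemma unital_placements:
  "unital_placement 2 2 (\<lambda>u. [u!1, u!0])"
  "unital_placement 2 3 (\<lambda>u. [u!0, u!1, 1])"
  "unital_placement 2 3 (\<lambda>u. [u!1, u!0, 1])"
  "unital_placement 2 3 (\<lambda>u. [u!0, 1, u!1])"
  "unital_placement 2 3 (\<lambda>u. [u!1, 1, u!0])"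
  "unital_placement 2 3 (\<lambda>u. [1, u!0, u!1])"
  "unital_placement 2 3 (\<lambda>u. [1, u!1, u!0])"
  "unital_placement 3 3 (\<lambda>u. [u!0, u!1, u!2])"
  "unital_placement 3 3 (\<lambda>u. [u!0, u!2, u!1])"
  "unital_placement 3 3 (\<lambda>u. [u!1, u!0, u!2])"
  "unital_placement 3 3 (\<lambda>u. [u!1, u!2, u!0])"
  "unital_placement 3 3 (\<lambda>u. [u!2, u!0, u!1])"
  "unital_placement 3 3 (\<lambda>u. [u!2, u!1, u!0])"
  "unital_placement 3 4 (\<lambda>u. [u!0, u!1, u!2, 1])"
  "unital_placement 3 4 (\<lambda>u. [1, u!0, u!1, u!2])"
  by (auto simp: placement_simps One_nat_def)

lemmas placements = unital_placements [THEN unital_placement_placement]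
lemmas rearrange_algs = unital_placements [THEN rearrange_alg_map]
lemmas rearrange_pures = placements [THEN rearrange_pure]

lemma rearrange_rearrange:
  assumes x: "x \<in> carrier (T n)" and g: "placement n m g" and h: "placement m l h"
  shows "rearrange scale l h (rearrange scale m g x) = rearrange scale l (\<lambda>u. h (g u)) x"
  using lin_map_comp [OF rearrange_lin_map [OF g] rearrange_lin_map [OF h]]
    rearrange_lin_map [OF placement_comp [OF g h]] _ x
  by (rule lin_map_eqI)
    (simp add: rearrange_pure [OF g] rearrange_pure [OF h] rearrange_pure [OF placement_comp [OF g h]]
      placement_length [OF g])

lemma list_of_length:
  "length u = 2 \<Longrightarrow> u = [u!0, u!1]" "length u = 3 \<Longrightarrow> u = [u!0, u!1, u!2]"
  by (auto simp: numeral_eq_Suc length_Suc_conv One_nat_def)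

lemma rearrange_id: "x \<in> carrier (T 3) \<Longrightarrow> rearrange scale 3 (\<lambda>u. [u!0, u!1, u!2]) x = x"
  by (rule lin_map_eqI [OF rearrange_lin_map lin_map_id])
    (simp_all add: placements rearrange_pures list_of_length(2) [symmetric])

lemma lin_map_mult:
  assumes "lin_map A (T n) F" "y \<in> carrier (T n)"
  shows "lin_map A (T n) (\<lambda>x. y \<otimes>\<^bsub>T n\<^esub> F x)" "lin_map A (T n) (\<lambda>x. F x \<otimes>\<^bsub>T n\<^esub> y)"
proof -
  interpret T: assoc_algebra "T n" by simp
  show "lin_map A (T n) (\<lambda>x. y \<otimes>\<^bsub>T n\<^esub> F x)" "lin_map A (T n) (\<lambda>x. F x \<otimes>\<^bsub>T n\<^esub> y)"
    using assms by (auto simp: lin_map_def Pi_iff T.r_distr T.l_distr T.smult_mult_right T.smult_mult_left)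
qed

lemma lin_map_smult:
  assumes "lin_map A (T n) F"
  shows "lin_map A (T n) (\<lambda>x. c \<odot>\<^bsub>T n\<^esub> F x)"
proof -
  interpret T: assoc_algebra "T n" by simp
  show ?thesis
    using assms by (auto simp: lin_map_def Pi_iff T.smult_add_right T.smult_smult mult.commute)
qed

lemma pure_slot_lin_map:
  "length u = n \<Longrightarrow> i < n \<Longrightarrow> lin_map regular (T n) (\<lambda>a. pure (u[i := a]))"
  using pure_multilin [of n] by (simp add: lin_map_def multilin_def)


lemma length_2E: "length u = 2 \<Longrightarrow> (\<And>a b. u = [a, b] \<Longrightarrow> thesis) \<Longrightarrow> thesis"
  and length_3E: "length u = 3 \<Longrightarrow> (\<And>a b c. u = [a, b, c] \<Longrightarrow> thesis) \<Longrightarrow> thesis"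
  using list_of_length by blast+

lemmas rearrange_lins = placements [THEN rearrange_lin_map]

lemmas word_simps = nth_Cons' take_Cons' drop_Cons'

section \<open>Inserting a two-fold tensor in place of a letter\<close>

text \<open>
  The two-fold tensor takes the place of the \<open>i\<close>-th letter of \<open>u\<close>. With \<open>\<Delta>(u ! i)\<close> inserted this is
  the value of the coproduct on a pure tensor; with \<open>n = 2\<close> and units as the letters of
  \<open>u\<close> it is the embedding \<open>x \<mapsto> x\<^sub>1\<^sub>2\<close> or \<open>x \<mapsto> x\<^sub>2\<^sub>3\<close>.
\<close>

definition insertion :: "nat \<Rightarrow> nat \<Rightarrow> 'h list \<Rightarrow> ('h, 'k) tensor \<Rightarrow> ('h, 'k) tensor" where
  "insertion n i u = rearrange scale (n + 1) (\<lambda>v. take i u @ v @ drop (i + 1) u)"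

lemma insertion_placement:
  assumes "length u = n" "i < n"
  shows "placement 2 (n + 1) (\<lambda>v. take i u @ v @ drop (i + 1) u)"
  unfolding placement_def
proof (intro conjI allI impI)
  fix j :: nat assume "j < 2"
  then show "\<exists>k<n + 1. \<forall>v a. length v = 2 \<longrightarrow>
      take i u @ v[j := a] @ drop (i + 1) u = (take i u @ v @ drop (i + 1) u)[k := a]"
    using assms by (intro exI [of _ "i + j"]) (auto simp: list_update_append)
qed (use assms in auto)

lemma insertion_lin_map:
  "length u = n \<Longrightarrow> i < n \<Longrightarrow> lin_map (T 2) (T (n + 1)) (insertion n i u)"
  unfolding insertion_def by (rule rearrange_lin_map [OF insertion_placement])

lemma insertion_pure:
  "length u = n \<Longrightarrow> i < n \<Longrightarrow> length v = 2 \<Longrightarrow>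
    insertion n i u (pure v) = pure (take i u @ v @ drop (i + 1) u)"
  unfolding insertion_def by (rule rearrange_pure [OF insertion_placement])

lemma insertion_mult:
  assumes u: "length u = n" and v: "length v = n" and i: "i < n"
    and x: "x \<in> carrier (T 2)" and y: "y \<in> carrier (T 2)"
  shows "insertion n i (map2 (*) u v) (x \<otimes>\<^bsub>T 2\<^esub> y)
    = insertion n i u x \<otimes>\<^bsub>T (n + 1)\<^esub> insertion n i v y"
  by (rule lin_map_multI [OF T_algebra(1) insertion_lin_map [OF u i] insertion_lin_map [OF v i]
        insertion_lin_map [OF _ i] _ x y])
    (use u v i in \<open>auto simp: insertion_pure pure_mult take_map take_zip drop_map drop_zip\<close>)

text \<open>
  On a pure tensor, a letter of \<open>u\<close> other than the replaced one ends up at a fixed place of the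
  resulting word, so linearity in that letter is that of \<open>pure\<close>.
\<close>

lemma insertion_update:
  assumes u: "length u = n" and i: "i < n" and k: "k < n" "k \<noteq> i" and x: "x \<in> carrier (T 2)"
  shows "insertion n i (u[k := a + b]) x = insertion n i (u[k := a]) x \<oplus>\<^bsub>T (n + 1)\<^esub> insertion n i (u[k := b]) x"
    and "insertion n i (u[k := scale c a]) x = c \<odot>\<^bsub>T (n + 1)\<^esub> insertion n i (u[k := a]) x"
proof -
  interpret T: assoc_algebra "T (n + 1)" by simp
  have *: "\<exists>w j. length w = n + 1 \<and> j < n + 1 \<and>
       (\<forall>a. insertion n i (u[k := a]) (pure v) = pure (w[j := a]))" if "length v = 2" for v
  proof (cases "k < i")
    case True
    then have "take i (u[k := a]) = (take i u)[k := a]" "drop (i + 1) (u[k := a]) = drop (i + 1) u" for a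
      by (auto simp: take_update_swap)
    then show ?thesis using u i k True that
      by (intro exI [of _ "take i u @ v @ drop (i + 1) u"] exI [of _ k])
        (auto simp: insertion_pure list_update_append)
  next
    case False
    then show ?thesis using u i k that
      by (intro exI [of _ "take i u @ v @ drop (i + 1) u"] exI [of _ "k + 1"])
        (auto simp: insertion_pure list_update_append drop_update_swap One_nat_def)
  qed
  note lin = insertion_lin_map [of "u[k := z]" n i for z, simplified, OF u i]
  show "insertion n i (u[k := a + b]) x = insertion n i (u[k := a]) x \<oplus>\<^bsub>T (n + 1)\<^esub> insertion n i (u[k := b]) x"
    using x
  proof (induct x rule: tensor_induct)
    case (pure v)
    then show ?case using *[OF pure] pure_multilin [of "n + 1"] unfolding multilin_def by metis
  qed (simp_all add: lin_mapD [OF lin] T.smult_add_right T.a_ac)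
  show "insertion n i (u[k := scale c a]) x = c \<odot>\<^bsub>T (n + 1)\<^esub> insertion n i (u[k := a]) x"
    using x
  proof (induct x rule: tensor_induct)
    case (pure v)
    then show ?case using *[OF pure] pure_multilin [of "n + 1"] unfolding multilin_def by metis
  qed (simp_all add: lin_mapD [OF lin] T.smult_add_right T.smult_smult mult.commute)
qed

lemma lift_cong:
  assumes M: "assoc_algebra M" and f: "multilin M n f" and fg: "\<And>u. length u = n \<Longrightarrow> g u = f u"
    and x: "x \<in> carrier (T n)"
  shows "lift M g x = lift M f x"
proof -
  have g: "multilin M n g" using f by (simp add: multilin_def fg)
  show ?thesis
    by (rule lin_map_eqI [OF lift_lin_map [OF M g] lift_lin_map [OF M f] _ x])
      (simp add: fg lift_pure [OF M g] lift_pure [OF M f])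
qed

lemma flip_alg_map: "alg_map (T 2) (T 2) (flip scale)"
  unfolding flip_def by (rule rearrange_algs(1))

lemma flip_pure: "length u = 2 \<Longrightarrow> flip scale (pure u) = pure [u!1, u!0]"
  unfolding flip_def by (rule rearrange_pures(1))

lemmas flip_lin = flip_alg_map [THEN alg_map_lin]

lemma flip_flip: "x \<in> carrier (T 2) \<Longrightarrow> flip scale (flip scale x) = x"
  by (rule lin_map_eqI [OF lin_map_comp [OF flip_lin flip_lin] lin_map_id])
    (auto elim!: length_2E simp: flip_pure word_simps)

lemma insertion_unit:
  assumes x: "x \<in> carrier (T 2)"
  shows "insertion 2 0 [1, 1] x = rearrange scale 3 (\<lambda>u. [u!0, u!1, 1]) x"
    and "insertion 2 1 [1, 1] x = rearrange scale 3 (\<lambda>u. [1, u!0, u!1]) x"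
proof -
  have ins: "i < 2 \<Longrightarrow> lin_map (T 2) (T 3) (insertion 2 i [1, 1])" for i
    using insertion_lin_map [of "[1, 1]" 2 i] by simp
  show "insertion 2 0 [1, 1] x = rearrange scale 3 (\<lambda>u. [u!0, u!1, 1]) x"
    by (rule lin_map_eqI [OF ins rearrange_lins(2) _ x])
      (auto elim!: length_2E simp: insertion_pure rearrange_pures word_simps)
  show "insertion 2 1 [1, 1] x = rearrange scale 3 (\<lambda>u. [1, u!0, u!1]) x"
    by (rule lin_map_eqI [OF ins rearrange_lins(6) _ x])
      (auto elim!: length_2E simp: insertion_pure rearrange_pures word_simps)
qed

lemma insertion_flip:
  assumes u: "length u = 2" and x: "x \<in> carrier (T 2)"
  shows "rearrange scale 3 (\<lambda>u. [u!1, u!0, u!2]) (insertion 2 0 u x) = insertion 2 0 u (flip scale x)"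
    and "insertion 2 0 [u!1, u!0] x = rearrange scale 3 (\<lambda>u. [u!1, u!2, u!0]) (insertion 2 1 u x)"
    and "insertion 2 1 [u!1, u!0] x = rearrange scale 3 (\<lambda>u. [u!2, u!0, u!1]) (insertion 2 0 u x)"
proof -
  have ins: "lin_map (T 2) (T 3) (insertion 2 i v)" if "length v = 2" "i < 2" for i v
    using insertion_lin_map [OF that] by simp
  show "rearrange scale 3 (\<lambda>u. [u!1, u!0, u!2]) (insertion 2 0 u x) = insertion 2 0 u (flip scale x)"
    by (rule lin_map_eqI [OF lin_map_comp [OF ins rearrange_lins(10)] lin_map_comp [OF flip_lin ins] _ x])
      (use u in \<open>auto elim!: length_2E simp: flip_pure insertion_pure rearrange_pures word_simps\<close>)
  show "insertion 2 0 [u!1, u!0] x = rearrange scale 3 (\<lambda>u. [u!1, u!2, u!0]) (insertion 2 1 u x)"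
    by (rule lin_map_eqI [OF ins lin_map_comp [OF ins rearrange_lins(11)] _ x])
      (use u in \<open>auto elim!: length_2E simp: insertion_pure rearrange_pures word_simps\<close>)
  show "insertion 2 1 [u!1, u!0] x = rearrange scale 3 (\<lambda>u. [u!2, u!0, u!1]) (insertion 2 0 u x)"
    by (rule lin_map_eqI [OF ins lin_map_comp [OF ins rearrange_lins(12)] _ x])
      (use u in \<open>auto elim!: length_2E simp: insertion_pure rearrange_pures word_simps\<close>)
qed

end


section \<open>Coproduct and counit on one tensor factor\<close>

context quasi_bialgebra
begin

abbreviation coprod_at where "coprod_at n i \<equiv> apply_coprod scale \<Delta> n i"

text \<open>
  Linearity in the letter \<open>u ! i\<close> is linearity of \<open>\<Delta>\<close>, because that letter does not enter the
  insertion otherwise.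
\<close>

lemma coprod_multilin:
  assumes i: "i < n"
  shows "multilin (T (n + 1)) n (\<lambda>u. insertion n i u (\<Delta> (u ! i)))"
proof -
  have *: "insertion n i (u[i := x]) = insertion n i u" if "length u = n" for u x
    using that by (simp add: insertion_def)
  have "insertion n i (u[k := a + b]) (\<Delta> (u[k := a + b] ! i)) =
      insertion n i (u[k := a]) (\<Delta> (u[k := a] ! i)) \<oplus>\<^bsub>T (n + 1)\<^esub> insertion n i (u[k := b]) (\<Delta> (u[k := b] ! i)) \<and>
    insertion n i (u[k := scale c a]) (\<Delta> (u[k := scale c a] ! i)) =
      c \<odot>\<^bsub>T (n + 1)\<^esub> insertion n i (u[k := a]) (\<Delta> (u[k := a] ! i))"
    if u: "length u = n" and k: "k < n" for u k a b c
    by (cases "k = i")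
      (use i u k in \<open>simp_all add: insertion_update coprod_closed coprod_add coprod_scale * lin_mapD [OF insertion_lin_map [OF u i]]\<close>)
  then show ?thesis unfolding multilin_def
    using i by (auto intro!: lin_mapD(1) [OF insertion_lin_map] coprod_closed)
qed

lemma coprod_at_lift: "coprod_at n i = lift (T (n + 1)) (\<lambda>u. insertion n i u (\<Delta> (u ! i)))"
  by (simp add: apply_coprod_def tensor_lift_eq insertion_def)

lemma coprod_at_pure: "i < n \<Longrightarrow> length u = n \<Longrightarrow> coprod_at n i (pure u) = insertion n i u (\<Delta> (u ! i))"
  unfolding coprod_at_lift by (rule lift_pure [OF T_algebra(1) coprod_multilin])

lemma coprod_at_alg_map:
  assumes i: "i < n" shows "alg_map (T n) (T (n + 1)) (coprod_at n i)"
proof (rule alg_mapI)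
  show "lin_map (T n) (T (n + 1)) (coprod_at n i)"
    unfolding coprod_at_lift by (rule lift_lin_map [OF T_algebra(1) coprod_multilin [OF i]])
  show "coprod_at n i (pure (map2 (*) u v)) = coprod_at n i (pure u) \<otimes>\<^bsub>T (n + 1)\<^esub> coprod_at n i (pure v)"
    if "length u = n" "length v = n" for u v
    using that i by (simp add: coprod_at_pure coprod_mult insertion_mult coprod_closed)
  have "insertion n i (replicate n 1) (pure (replicate 2 1)) = pure (replicate (n + 1) 1)"
    using i by (auto intro!: arg_cong [of _ _ pure] nth_equalityI simp: insertion_pure nth_append nth_Cons')
  then show "coprod_at n i (pure (replicate n 1)) = \<one>\<^bsub>T (n + 1)\<^esub>"
    using i by (simp add: coprod_at_pure T_one coprod_one)
qed simp

lemma coprod_at_algs: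
  "alg_map (T 2) (T 3) (coprod_at 2 0)" "alg_map (T 2) (T 3) (coprod_at 2 1)"
  "alg_map (T 3) (T 4) (coprod_at 3 0)" "alg_map (T 3) (T 4) (coprod_at 3 1)" "alg_map (T 3) (T 4) (coprod_at 3 2)"
  using coprod_at_alg_map [of _ 2] coprod_at_alg_map [of _ 3] by simp_all

lemma counit_simps: "\<epsilon> (a + b) = \<epsilon> a + \<epsilon> b" "\<epsilon> (scale c a) = c * \<epsilon> a"
proof -
  interpret counit: Vector_Spaces.linear scale "(*)" \<epsilon> by (rule counit_linear)
  show "\<epsilon> (a + b) = \<epsilon> a + \<epsilon> b" "\<epsilon> (scale c a) = c * \<epsilon> a"
    by (rule counit.add, rule counit.scale)
qed

text \<open>
  The map \<open>1 \<otimes> \<dots> \<otimes> \<epsilon> \<otimes> \<dots> \<otimes> 1\<close> from the \<open>(n+1)\<close>-st to the \<open>n\<close>-th tensor power.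
\<close>

definition counit_at :: "nat \<Rightarrow> nat \<Rightarrow> ('h, 'k) tensor \<Rightarrow> ('h, 'k) tensor" where
  "counit_at n i = tensor_lift scale n (\<lambda>u. \<epsilon> (u ! i) \<odot>\<^bsub>T n\<^esub> pure (take i u @ drop (i + 1) u))"

lemma counit_at_multilin:
  assumes i: "i \<le> n"
  shows "multilin (T n) (n + 1) (\<lambda>u. \<epsilon> (u ! i) \<odot>\<^bsub>T n\<^esub> pure (take i u @ drop (i + 1) u))"
proof -
  interpret T: assoc_algebra "T n" by simp
  have slot: "\<exists>j<n. \<forall>a. take i (u[k := a]) @ drop (i + 1) (u[k := a]) = (take i u @ drop (i + 1) u)[j := a]"
    if u: "length u = n + 1" and k: "k < n + 1" "k \<noteq> i" for u :: "'h list" and k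
  proof (cases "k < i")
    case True
    then show ?thesis using u k i
      by (intro exI [of _ k]) (auto simp: list_update_append take_update_swap)
  next
    case False
    then show ?thesis using u k i
      by (intro exI [of _ "k - 1"]) (auto simp: list_update_append drop_update_swap add.commute)
  qed
  have other: "pure (take i (u[k := a + b]) @ drop (i + 1) (u[k := a + b]))
      = pure (take i (u[k := a]) @ drop (i + 1) (u[k := a])) \<oplus>\<^bsub>T n\<^esub> pure (take i (u[k := b]) @ drop (i + 1) (u[k := b]))"
    "pure (take i (u[k := scale c a]) @ drop (i + 1) (u[k := scale c a]))
      = c \<odot>\<^bsub>T n\<^esub> pure (take i (u[k := a]) @ drop (i + 1) (u[k := a]))"
    if slots: "length u = n + 1" "k < n + 1" "k \<noteq> i" for u k a b c
  proof -
    obtain j where j: "j < n"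
        "\<And>a. take i (u[k := a]) @ drop (i + 1) (u[k := a]) = (take i u @ drop (i + 1) u)[j := a]"
      using slot [OF slots] by blast
    have l: "length (take i u @ drop (i + 1) u) = n" using slots i by auto
    show "pure (take i (u[k := a + b]) @ drop (i + 1) (u[k := a + b]))
      = pure (take i (u[k := a]) @ drop (i + 1) (u[k := a])) \<oplus>\<^bsub>T n\<^esub> pure (take i (u[k := b]) @ drop (i + 1) (u[k := b]))"
      "pure (take i (u[k := scale c a]) @ drop (i + 1) (u[k := scale c a]))
      = c \<odot>\<^bsub>T n\<^esub> pure (take i (u[k := a]) @ drop (i + 1) (u[k := a]))"
      unfolding j(2) using pure_multilin [of n] l j(1) unfolding multilin_def by blast+
  qed
  show ?thesis unfolding multilin_def
  proof (intro conjI allI impI)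
    fix u :: "'h list" and k a b c assume u: "length u = n + 1" and k: "k < n + 1"
    have [simp]: "length (take i u @ drop (i + 1) u) = n" using u i by auto
    show "\<epsilon> (u[k := a + b] ! i) \<odot>\<^bsub>T n\<^esub> pure (take i (u[k := a + b]) @ drop (i + 1) (u[k := a + b]))
      = \<epsilon> (u[k := a] ! i) \<odot>\<^bsub>T n\<^esub> pure (take i (u[k := a]) @ drop (i + 1) (u[k := a]))
      \<oplus>\<^bsub>T n\<^esub> \<epsilon> (u[k := b] ! i) \<odot>\<^bsub>T n\<^esub> pure (take i (u[k := b]) @ drop (i + 1) (u[k := b]))"
      by (cases "k = i") (use u k i other in \<open>auto simp: counit_simps T.smult_add_left T.smult_add_right\<close>)
    show "\<epsilon> (u[k := scale c a] ! i) \<odot>\<^bsub>T n\<^esub> pure (take i (u[k := scale c a]) @ drop (i + 1) (u[k := scale c a]))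
      = c \<odot>\<^bsub>T n\<^esub> (\<epsilon> (u[k := a] ! i) \<odot>\<^bsub>T n\<^esub> pure (take i (u[k := a]) @ drop (i + 1) (u[k := a])))"
      by (cases "k = i") (use u k i other in \<open>auto simp: counit_simps T.smult_smult mult.commute\<close>)
  qed (use i in auto)
qed

lemma counit_at_pure:
  "i \<le> n \<Longrightarrow> length u = n + 1 \<Longrightarrow> counit_at n i (pure u) = \<epsilon> (u ! i) \<odot>\<^bsub>T n\<^esub> pure (take i u @ drop (i + 1) u)"
  unfolding counit_at_def tensor_lift_eq by (rule lift_pure [OF T_algebra(1) counit_at_multilin])

lemma counit_at_alg_map:
  assumes i: "i \<le> n" shows "alg_map (T (n + 1)) (T n) (counit_at n i)"
proof (rule alg_mapI)
  interpret T: assoc_algebra "T n" by simp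
  show "lin_map (T (n + 1)) (T n) (counit_at n i)"
    unfolding counit_at_def tensor_lift_eq by (rule lift_lin_map [OF T_algebra(1) counit_at_multilin [OF i]])
  show "counit_at n i (pure (map2 (*) u v)) = counit_at n i (pure u) \<otimes>\<^bsub>T n\<^esub> counit_at n i (pure v)"
    if "length u = n + 1" "length v = n + 1" for u v
    using that i by (simp add: counit_at_pure counit_mult T.smult_mult_left T.smult_mult_right T.smult_smult
        pure_mult take_map take_zip drop_map drop_zip mult.commute)
  show "counit_at n i (pure (replicate (n + 1) 1)) = \<one>\<^bsub>T n\<^esub>"
    using i by (simp add: counit_at_pure counit_one T.smult_one T_one replicate_add [symmetric] del: replicate_Suc)
qed simp

lemma counit_at_algs:
  "alg_map (T 3) (T 2) (counit_at 2 1)" "alg_map (T 3) (T 2) (counit_at 2 2)"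
  "alg_map (T 4) (T 3) (counit_at 3 2)"
  using counit_at_alg_map [of _ 2] counit_at_alg_map [of _ 3] by simp_all

abbreviation counit_fst where "counit_fst \<equiv> tensor_contract scale (\<lambda>u. scale (\<epsilon> (u!0)) (u!1))"
abbreviation counit_snd where "counit_snd \<equiv> tensor_contract scale (\<lambda>u. scale (\<epsilon> (u!1)) (u!0))"

lemma contract_multilin:
  "multilin regular 2 (\<lambda>u. scale (\<epsilon> (u!0)) (u!1))" "multilin regular 2 (\<lambda>u. scale (\<epsilon> (u!1)) (u!0))"
  by (auto simp: multilin_def nth_list_update counit_simps scale_left_distrib scale_right_distrib less_2_cases_iff
      mult.commute)

lemma contract_pure:
  assumes "length u = 2"
  shows "counit_fst (pure u) = scale (\<epsilon> (u!0)) (u!1)" "counit_snd (pure u) = scale (\<epsilon> (u!1)) (u!0)"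
  unfolding tensor_contract_eq
  by (rule lift_pure [OF regular_algebra contract_multilin(1) assms] lift_pure [OF regular_algebra contract_multilin(2) assms])+

lemmas contract_lin_map =
  lift_lin_map [OF regular_algebra contract_multilin(1), folded tensor_contract_eq]
  lift_lin_map [OF regular_algebra contract_multilin(2), folded tensor_contract_eq]

lemma contract_alg_map: "alg_map (T 2) regular counit_fst" "alg_map (T 2) regular counit_snd"
  by (rule alg_mapI [OF regular_algebra contract_lin_map(1)]
      alg_mapI [OF regular_algebra contract_lin_map(2)];
      simp add: contract_pure counit_mult counit_one scale_mult_left scale_mult_right mult.commute)+

lemma counit_at_insertion:
  assumes u: "length u = n" and i: "i < n" and x: "x \<in> carrier (T 2)"
  shows "counit_at n i (insertion n i u x) = pure (u[i := counit_fst x])"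
    and "counit_at n (i + 1) (insertion n i u x) = pure (u[i := counit_snd x])"
proof -
  note ins = insertion_lin_map [OF u i]
  have pu: "pure (u[i := scale c a]) = c \<odot>\<^bsub>T n\<^esub> pure (u[i := a])" for c a
    using lin_mapD(3) [OF pure_slot_lin_map [OF u i]] by simp
  show "counit_at n i (insertion n i u x) = pure (u[i := counit_fst x])"
    using lin_map_comp [OF ins alg_map_lin [OF counit_at_alg_map]] lin_map_comp [OF contract_lin_map(1) pure_slot_lin_map [OF u i]] _ x
  proof (rule lin_map_eqI)
    fix v :: "'h list" assume v: "length v = 2"
    have "(take i u @ v @ drop (i + 1) u) ! i = v ! 0"
      "take i (take i u @ v @ drop (i + 1) u) @ drop (i + 1) (take i u @ v @ drop (i + 1) u) = u[i := v ! 1]"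
      using u i v by (auto elim!: length_2E simp: nth_append upd_conv_take_nth_drop One_nat_def)
    then show "counit_at n i (insertion n i u (pure v)) = pure (u[i := counit_fst (pure v)])"
      using u i v by (simp add: insertion_pure counit_at_pure contract_pure pu)
  qed (use i in simp)
  show "counit_at n (i + 1) (insertion n i u x) = pure (u[i := counit_snd x])"
    using lin_map_comp [OF ins alg_map_lin [OF counit_at_alg_map]] lin_map_comp [OF contract_lin_map(2) pure_slot_lin_map [OF u i]] _ x
  proof (rule lin_map_eqI)
    fix v :: "'h list" assume v: "length v = 2"
    have "(take i u @ v @ drop (i + 1) u) ! (i + 1) = v ! 1"
      "take (i + 1) (take i u @ v @ drop (i + 1) u) @ drop (i + 1 + 1) (take i u @ v @ drop (i + 1) u) = u[i := v ! 0]"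
      using u i v by (auto elim!: length_2E simp: nth_append upd_conv_take_nth_drop One_nat_def)
    then show "counit_at n (i + 1) (insertion n i u (pure v)) = pure (u[i := counit_snd (pure v)])"
      using u i v by (simp add: insertion_pure counit_at_pure contract_pure pu)
  qed (use i in simp)
qed

text \<open>
  The counit axiom \<open>(\<epsilon> \<otimes> 1)\<Delta> = 1 = (1 \<otimes> \<epsilon>)\<Delta>\<close>, applied inside a tensor factor.
\<close>

lemma counit_at_coprod_at:
  assumes i: "i < n" and x: "x \<in> carrier (T n)"
  shows "counit_at n i (coprod_at n i x) = x" and "counit_at n (i + 1) (coprod_at n i x) = x"
proof -
  note lin = alg_map_lin [OF coprod_at_alg_map [OF i]]
  show "counit_at n i (coprod_at n i x) = x"
    by (rule lin_map_eqI [OF lin_map_comp [OF lin alg_map_lin [OF counit_at_alg_map]] lin_map_id _ x])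
      (use i in \<open>simp_all add: coprod_at_pure counit_at_insertion coprod_closed counit_left\<close>)
  show "counit_at n (i + 1) (coprod_at n i x) = x"
    by (rule lin_map_eqI [OF lin_map_comp [OF lin alg_map_lin [OF counit_at_alg_map]] lin_map_id _ x])
      (use i in \<open>simp_all add: coprod_at_pure counit_at_insertion coprod_closed counit_right\<close>)
qed

lemmas counit_at_lins = counit_at_algs [THEN alg_map_lin]
lemmas coprod_at_lins = coprod_at_algs [THEN alg_map_lin]
lemma counit_at_coprod_at_far:
  assumes x: "x \<in> carrier (T 3)"
  shows "counit_at 3 2 (coprod_at 3 0 x) = coprod_at 2 0 (counit_at 2 1 x)"
proof (rule lin_map_eqI [OF lin_map_comp [OF coprod_at_lins(3) counit_at_lins(3)] lin_map_comp [OF counit_at_lins(1) coprod_at_lins(1)] _ x])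
  fix u :: "'h list" assume u: "length u = 3"
  define v where "v = [u!0, u!2]"
  have i: "lin_map (T 2) (T 4) (insertion 3 0 u)" "lin_map (T 2) (T 3) (insertion 2 0 v)"
    using insertion_lin_map [OF u, of 0] insertion_lin_map [of v 2 0] by (simp_all add: v_def)
  have "counit_at 3 2 (insertion 3 0 u y) = \<epsilon> (u!1) \<odot>\<^bsub>T 3\<^esub> insertion 2 0 v y" if "y \<in> carrier (T 2)" for y
    using lin_map_comp [OF i(1) counit_at_lins(3)] lin_map_smult [OF i(2)] _ that
  proof (rule lin_map_eqI)
    fix w :: "'h list" assume w: "length w = 2"
    show "counit_at 3 2 (insertion 3 0 u (pure w)) = \<epsilon> (u!1) \<odot>\<^bsub>T 3\<^esub> insertion 2 0 v (pure w)"
      using u w by (auto elim!: length_2E length_3E simp: insertion_pure counit_at_pure v_def word_simps)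
  qed
  moreover have "counit_at 2 1 (pure u) = \<epsilon> (u!1) \<odot>\<^bsub>T 2\<^esub> pure v"
    using u by (auto elim!: length_3E simp: counit_at_pure v_def word_simps)
  ultimately show "counit_at 3 2 (coprod_at 3 0 (pure u)) = coprod_at 2 0 (counit_at 2 1 (pure u))"
    using u by (simp add: coprod_at_pure coprod_closed lin_mapD(3) [OF coprod_at_lins(1)] v_def)
qed

lemma counit_at_rearrange:
  assumes x: "x \<in> carrier (T 3)"
  shows "counit_at 3 2 (rearrange scale 4 (\<lambda>u. [u!0, u!1, u!2, 1]) x) = rearrange scale 3 (\<lambda>u. [u!0, u!1, 1]) (counit_at 2 2 x)"
    "counit_at 3 2 (rearrange scale 4 (\<lambda>u. [1, u!0, u!1, u!2]) x) = rearrange scale 3 (\<lambda>u. [1, u!0, u!1]) (counit_at 2 1 x)"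
    "counit_at 2 1 (rearrange scale 3 (\<lambda>u. [u!0, u!2, u!1]) x) = counit_at 2 2 x"
    "counit_at 2 1 (rearrange scale 3 (\<lambda>u. [u!1, u!2, u!0]) x) = flip scale (counit_at 2 2 x)"
    "counit_at 2 2 (rearrange scale 3 (\<lambda>u. [u!2, u!0, u!1]) x) = flip scale (counit_at 2 1 x)"
    "counit_at 2 2 (rearrange scale 3 (\<lambda>u. [u!1, u!0, u!2]) x) = flip scale (counit_at 2 2 x)"
proof -
  note simps = rearrange_pures counit_at_pure word_simps lin_mapD(3) [OF rearrange_lins(1)]
    lin_mapD(3) [OF rearrange_lins(2)] lin_mapD(3) [OF rearrange_lins(6)]
  show "counit_at 3 2 (rearrange scale 4 (\<lambda>u. [u!0, u!1, u!2, 1]) x) = rearrange scale 3 (\<lambda>u. [u!0, u!1, 1]) (counit_at 2 2 x)"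
    unfolding flip_def
    by (rule lin_map_eqI [OF lin_map_comp [OF rearrange_lins(14) counit_at_lins(3)] lin_map_comp [OF counit_at_lins(2) rearrange_lins(2)] _ x])
      (erule length_3E, simp add: simps)
  show "counit_at 3 2 (rearrange scale 4 (\<lambda>u. [1, u!0, u!1, u!2]) x) = rearrange scale 3 (\<lambda>u. [1, u!0, u!1]) (counit_at 2 1 x)"
    unfolding flip_def
    by (rule lin_map_eqI [OF lin_map_comp [OF rearrange_lins(15) counit_at_lins(3)] lin_map_comp [OF counit_at_lins(1) rearrange_lins(6)] _ x])
      (erule length_3E, simp add: simps)
  show "counit_at 2 1 (rearrange scale 3 (\<lambda>u. [u!0, u!2, u!1]) x) = counit_at 2 2 x"
    unfolding flip_def
    by (rule lin_map_eqI [OF lin_map_comp [OF rearrange_lins(9) counit_at_lins(1)] counit_at_lins(2) _ x])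
      (erule length_3E, simp add: simps)
  show "counit_at 2 1 (rearrange scale 3 (\<lambda>u. [u!1, u!2, u!0]) x) = flip scale (counit_at 2 2 x)"
    unfolding flip_def
    by (rule lin_map_eqI [OF lin_map_comp [OF rearrange_lins(11) counit_at_lins(1)] lin_map_comp [OF counit_at_lins(2) rearrange_lins(1)] _ x])
      (erule length_3E, simp add: simps)
  show "counit_at 2 2 (rearrange scale 3 (\<lambda>u. [u!2, u!0, u!1]) x) = flip scale (counit_at 2 1 x)"
    unfolding flip_def
    by (rule lin_map_eqI [OF lin_map_comp [OF rearrange_lins(12) counit_at_lins(2)] lin_map_comp [OF counit_at_lins(1) rearrange_lins(1)] _ x])
      (erule length_3E, simp add: simps)
  show "counit_at 2 2 (rearrange scale 3 (\<lambda>u. [u!1, u!0, u!2]) x) = flip scale (counit_at 2 2 x)"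
    unfolding flip_def
    by (rule lin_map_eqI [OF lin_map_comp [OF rearrange_lins(10) counit_at_lins(2)] lin_map_comp [OF counit_at_lins(2) rearrange_lins(1)] _ x])
      (erule length_3E, simp add: simps)
qed

lemma coprod_at_flip:
  assumes x: "x \<in> carrier (T 2)"
  shows "coprod_at 2 0 (flip scale x) = rearrange scale 3 (\<lambda>u. [u!1, u!2, u!0]) (coprod_at 2 1 x)"
    and "coprod_at 2 1 (flip scale x) = rearrange scale 3 (\<lambda>u. [u!2, u!0, u!1]) (coprod_at 2 0 x)"
proof -
  show "coprod_at 2 0 (flip scale x) = rearrange scale 3 (\<lambda>u. [u!1, u!2, u!0]) (coprod_at 2 1 x)"
    by (rule lin_map_eqI [OF lin_map_comp [OF flip_lin coprod_at_lins(1)] lin_map_comp [OF coprod_at_lins(2) rearrange_lins(11)] _ x])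
      (simp add: flip_pure coprod_at_pure insertion_flip(2) [symmetric] coprod_closed)
  show "coprod_at 2 1 (flip scale x) = rearrange scale 3 (\<lambda>u. [u!2, u!0, u!1]) (coprod_at 2 0 x)"
    by (rule lin_map_eqI [OF lin_map_comp [OF flip_lin coprod_at_lins(2)] lin_map_comp [OF coprod_at_lins(1) rearrange_lins(12)] _ x])
      (simp add: flip_pure coprod_at_pure insertion_flip(3) [symmetric] coprod_closed word_simps)
qed

text \<open>
  If \<open>y \<Delta>(a) = t(\<Delta>(a)) y\<close> in \<open>H \<otimes> H\<close>, the same holds after embedding \<open>y\<close> next to the factor on which
  the coproduct acts, because \<open>insertion\<close> is multiplicative; \<open>\<tau>\<close> is a map of the three-fold tensors that acts
  on inserted tensors as \<open>t\<close>. Taking \<open>y = R\<close> and \<open>t\<close> the flip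
  gives the braiding relation for \<open>R\<^sub>1\<^sub>2\<close>; taking \<open>t\<close> the identity gives centrality of a compatible twist.
\<close>

lemma coprod_at_intertwine:
  assumes y: "y \<in> carrier (T 2)" and t: "lin_map (T 2) (T 2) t" and \<tau>: "lin_map (T 3) (T 3) \<tau>" and i: "i < 2"
    and ins: "\<And>u x. length u = 2 \<Longrightarrow> x \<in> carrier (T 2) \<Longrightarrow> \<tau> (insertion 2 i u x) = insertion 2 i u (t x)"
    and comm: "\<And>a. y \<otimes>\<^bsub>T 2\<^esub> \<Delta> a = t (\<Delta> a) \<otimes>\<^bsub>T 2\<^esub> y"
    and x: "x \<in> carrier (T 2)"
  shows "insertion 2 i [1, 1] y \<otimes>\<^bsub>T 3\<^esub> coprod_at 2 i x = \<tau> (coprod_at 2 i x) \<otimes>\<^bsub>T 3\<^esub> insertion 2 i [1, 1] y"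
proof -
  have D: "lin_map (T 2) (T 3) (coprod_at 2 i)"
    using alg_map_lin [OF coprod_at_alg_map [OF i]] by simp
  have J: "insertion 2 i [1, 1] y \<in> carrier (T 3)"
    using lin_mapD(1) [OF insertion_lin_map [of "[1, 1]" 2 i], of y] i y by simp
  show ?thesis
  proof (rule lin_map_eqI [OF lin_map_mult(1) [OF D J] lin_map_mult(2) [OF lin_map_comp [OF D \<tau>] J] _ x])
    fix u :: "'h list" assume u: "length u = 2"
    have m: "insertion 2 i [1, 1] y \<otimes>\<^bsub>T 3\<^esub> insertion 2 i u z = insertion 2 i u (y \<otimes>\<^bsub>T 2\<^esub> z)"
      "insertion 2 i u z \<otimes>\<^bsub>T 3\<^esub> insertion 2 i [1, 1] y = insertion 2 i u (z \<otimes>\<^bsub>T 2\<^esub> y)"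
      if "z \<in> carrier (T 2)" for z
      using insertion_mult [of "[1, 1]" 2 u i y z] insertion_mult [of u 2 "[1, 1]" i z y] u i y that
      by (auto elim!: length_2E)
    show "insertion 2 i [1, 1] y \<otimes>\<^bsub>T 3\<^esub> coprod_at 2 i (pure u) = \<tau> (coprod_at 2 i (pure u)) \<otimes>\<^bsub>T 3\<^esub> insertion 2 i [1, 1] y"
      using u i by (simp add: coprod_at_pure ins coprod_closed m lin_mapD(1) [OF t] comm)
  qed
qed

lemma assoc_counit_second: "counit_at 2 1 \<Phi> = \<one>\<^bsub>T 2\<^esub>"
proof -
  interpret T3: monoid "T 3" by simp
  have "counit_at 2 1 \<Phi> = tensor_lift scale 2 (\<lambda>u. \<epsilon> (u!1) \<odot>\<^bsub>T 2\<^esub> pure [u!0, u!2]) \<Phi>"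
    unfolding counit_at_def tensor_lift_eq
    by (rule lift_cong [symmetric, OF T_algebra(1) counit_at_multilin])
      (use assoc_invertible in \<open>auto elim!: length_3E simp: word_simps\<close>)
  then show ?thesis by (simp add: assoc_counit)
qed

lemma counit_at_unit_insertion:
  assumes x: "x \<in> carrier (T 2)"
  shows "counit_at 2 2 (rearrange scale 3 (\<lambda>u. [u!0, u!1, 1]) x) = x"
    "counit_at 2 1 (rearrange scale 3 (\<lambda>u. [u!0, 1, u!1]) x) = x"
    "counit_at 2 1 (rearrange scale 3 (\<lambda>u. [1, u!0, u!1]) x) = pure [1, counit_fst x]"
    "counit_at 2 2 (rearrange scale 3 (\<lambda>u. [u!0, 1, u!1]) x) = pure [counit_snd x, 1]"
proof -
  interpret T2: assoc_algebra "T 2" by simp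
  have slot: "lin_map regular (T 2) (\<lambda>a. pure [1, a])" "lin_map regular (T 2) (\<lambda>a. pure [a, 1])"
    using pure_slot_lin_map [of "[1, 1]" 2 1] pure_slot_lin_map [of "[1, 1]" 2 0] by (simp_all add: One_nat_def)
  note simps = rearrange_pures counit_at_pure word_simps counit_one T2.smult_one contract_pure
    lin_mapD(3) [OF slot(1), simplified] lin_mapD(3) [OF slot(2), simplified]
  show "counit_at 2 2 (rearrange scale 3 (\<lambda>u. [u!0, u!1, 1]) x) = x"
    by (rule lin_map_eqI [OF lin_map_comp [OF rearrange_lins(2) counit_at_lins(2)] lin_map_id _ x])
      (auto elim!: length_2E simp: simps)
  show "counit_at 2 1 (rearrange scale 3 (\<lambda>u. [u!0, 1, u!1]) x) = x"
    by (rule lin_map_eqI [OF lin_map_comp [OF rearrange_lins(4) counit_at_lins(1)] lin_map_id _ x])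
      (auto elim!: length_2E simp: simps)
  show "counit_at 2 1 (rearrange scale 3 (\<lambda>u. [1, u!0, u!1]) x) = pure [1, counit_fst x]"
    by (rule lin_map_eqI [OF lin_map_comp [OF rearrange_lins(6) counit_at_lins(1)] lin_map_comp [OF contract_lin_map(1) slot(1)] _ x])
      (auto elim!: length_2E simp: simps)
  show "counit_at 2 2 (rearrange scale 3 (\<lambda>u. [u!0, 1, u!1]) x) = pure [counit_snd x, 1]"
    by (rule lin_map_eqI [OF lin_map_comp [OF rearrange_lins(4) counit_at_lins(2)] lin_map_comp [OF contract_lin_map(2) slot(2)] _ x])
      (auto elim!: length_2E simp: simps)
qed

text \<open>
  Under \<open>\<epsilon>\<close> on the third factor the pentagon becomes \<open>\<Phi> = (U \<otimes> 1) \<Phi>\<close> with \<open>U = (1 \<otimes> 1 \<otimes> \<epsilon>)\<Phi>\<close>: two of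
  the other terms reduce to \<open>(1 \<otimes> \<epsilon> \<otimes> 1)\<Phi> = 1\<close>, and two to \<open>\<Phi>\<close> by the counit axiom.
\<close>

lemma assoc_counit_third: "counit_at 2 2 \<Phi> = \<one>\<^bsub>T 2\<^esub>"
proof -
  interpret T2: monoid "T 2" by simp
  interpret T3: monoid "T 3" by simp
  interpret T4: monoid "T 4" by simp
  let ?J = "rearrange scale 3 (\<lambda>u. [u!0, u!1, 1]) (counit_at 2 2 \<Phi>)"
  have \<Phi>: "\<Phi> \<in> carrier (T 3)" using assoc_invertible by (rule T3.Units_closed)
  have U: "counit_at 2 2 \<Phi> \<in> carrier (T 2)" by (rule alg_mapD(1) [OF counit_at_algs(2) \<Phi>])
  have J: "?J \<in> carrier (T 3)" by (rule alg_mapD(1) [OF rearrange_algs(2) U])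
  have D: "coprod_at 3 0 \<Phi> \<in> carrier (T 4)" "coprod_at 3 1 \<Phi> \<in> carrier (T 4)" "coprod_at 3 2 \<Phi> \<in> carrier (T 4)"
    "rearrange scale 4 (\<lambda>u. [u!0, u!1, u!2, 1]) \<Phi> \<in> carrier (T 4)"
    "rearrange scale 4 (\<lambda>u. [1, u!0, u!1, u!2]) \<Phi> \<in> carrier (T 4)"
    using coprod_at_algs(3-5) rearrange_algs(14,15) \<Phi> by (auto dest: alg_mapD(1))
  have ED: "counit_at 3 2 (coprod_at 3 1 \<Phi>) = \<Phi>" "counit_at 3 2 (coprod_at 3 2 \<Phi>) = \<Phi>"
    using counit_at_coprod_at(2) [of 1 3 \<Phi>] counit_at_coprod_at(1) [of 2 3 \<Phi>] \<Phi> by simp_all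
  have "\<Phi> = counit_at 3 2 (coprod_at 3 0 \<Phi> \<otimes>\<^bsub>T 4\<^esub> coprod_at 3 2 \<Phi>)"
    using \<Phi> D by (simp add: alg_mapD(2) [OF counit_at_algs(3)] counit_at_coprod_at_far assoc_counit_second alg_mapD(3) [OF coprod_at_algs(1)] ED)
  also have "\<dots> = ?J \<otimes>\<^bsub>T 3\<^esub> \<Phi>"
    unfolding pentagon using \<Phi> D J
    by (simp add: alg_mapD(2) [OF counit_at_algs(3)] counit_at_rearrange assoc_counit_second ED alg_mapD(3) [OF rearrange_algs(6)])
  finally have "?J = \<one>\<^bsub>T 3\<^esub>" by (rule T3.unit_absorb(1) [OF assoc_invertible J, OF sym])
  then have "counit_at 2 2 ?J = \<one>\<^bsub>T 2\<^esub>" by (simp add: alg_mapD(3) [OF counit_at_algs(2)])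
  then show ?thesis by (simp add: counit_at_unit_insertion(1) [OF U])
qed

lemma contract_flip:
  assumes x: "x \<in> carrier (T 2)"
  shows "counit_fst (flip scale x) = counit_snd x" "counit_snd (flip scale x) = counit_fst x"
  by (rule lin_map_eqI [OF lin_map_comp [OF flip_lin contract_lin_map(1)] contract_lin_map(2) _ x],
      simp add: flip_pure contract_pure word_simps)
    (rule lin_map_eqI [OF lin_map_comp [OF flip_lin contract_lin_map(2)] contract_lin_map(1) _ x],
      simp add: flip_pure contract_pure word_simps)


section \<open>Compatible twists form a group\<close>

definition left_cocycle :: "('h, 'k) tensor \<Rightarrow> ('h, 'k) tensor" where
  "left_cocycle C = rearrange scale 3 (\<lambda>u. [u!0, u!1, 1]) C \<otimes>\<^bsub>T 3\<^esub> coprod_at 2 0 C"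

definition right_cocycle :: "('h, 'k) tensor \<Rightarrow> ('h, 'k) tensor" where
  "right_cocycle C = rearrange scale 3 (\<lambda>u. [1, u!0, u!1]) C \<otimes>\<^bsub>T 3\<^esub> coprod_at 2 1 C"

definition coprod_central :: "('h, 'k) tensor \<Rightarrow> bool" where
  "coprod_central C \<longleftrightarrow> C \<in> carrier (T 2) \<and> (\<forall>a. C \<otimes>\<^bsub>T 2\<^esub> \<Delta> a = \<Delta> a \<otimes>\<^bsub>T 2\<^esub> C)"

lemma cocycle_closed:
  assumes "x \<in> carrier (T 2)"
  shows "rearrange scale 3 (\<lambda>u. [u!0, u!1, 1]) x \<in> carrier (T 3)"
    "rearrange scale 3 (\<lambda>u. [1, u!0, u!1]) x \<in> carrier (T 3)"
    "coprod_at 2 0 x \<in> carrier (T 3)" "coprod_at 2 1 x \<in> carrier (T 3)"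
    "left_cocycle x \<in> carrier (T 3)" "right_cocycle x \<in> carrier (T 3)"
proof -
  interpret T3: monoid "T 3" by simp
  show *: "rearrange scale 3 (\<lambda>u. [u!0, u!1, 1]) x \<in> carrier (T 3)"
    "rearrange scale 3 (\<lambda>u. [1, u!0, u!1]) x \<in> carrier (T 3)"
    "coprod_at 2 0 x \<in> carrier (T 3)" "coprod_at 2 1 x \<in> carrier (T 3)"
    using assms coprod_at_algs(1,2) rearrange_algs(2,6) by (auto dest: alg_mapD(1))
  then show "left_cocycle x \<in> carrier (T 3)" "right_cocycle x \<in> carrier (T 3)" by (auto simp: left_cocycle_def right_cocycle_def)
qed

lemma coprod_central_coprod_at:
  assumes C: "coprod_central C" and x: "x \<in> carrier (T 2)"
  shows "rearrange scale 3 (\<lambda>u. [u!0, u!1, 1]) C \<otimes>\<^bsub>T 3\<^esub> coprod_at 2 0 x = coprod_at 2 0 x \<otimes>\<^bsub>T 3\<^esub> rearrange scale 3 (\<lambda>u. [u!0, u!1, 1]) C"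
    and "rearrange scale 3 (\<lambda>u. [1, u!0, u!1]) C \<otimes>\<^bsub>T 3\<^esub> coprod_at 2 1 x = coprod_at 2 1 x \<otimes>\<^bsub>T 3\<^esub> rearrange scale 3 (\<lambda>u. [1, u!0, u!1]) C"
  using coprod_at_intertwine [OF _ lin_map_id lin_map_id _ refl _ x, of C 0] coprod_at_intertwine [OF _ lin_map_id lin_map_id _ refl _ x, of C 1] C
  by (auto simp: coprod_central_def insertion_unit)

text \<open>
  The middle factors \<open>C'\<^sub>1\<^sub>2\<close> and \<open>(\<Delta> \<otimes> 1)C\<close> commute since \<open>C'\<close> commutes with coproducts, and
  likewise on the right.
\<close>

lemma cocycle_mult:
  assumes C: "coprod_central C" and C': "coprod_central C'"
  shows "left_cocycle (C \<otimes>\<^bsub>T 2\<^esub> C') = left_cocycle C \<otimes>\<^bsub>T 3\<^esub> left_cocycle C'" "right_cocycle (C \<otimes>\<^bsub>T 2\<^esub> C') = right_cocycle C \<otimes>\<^bsub>T 3\<^esub> right_cocycle C'"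
proof -
  interpret T3: monoid "T 3" by simp
  have c: "C \<in> carrier (T 2)" "C' \<in> carrier (T 2)" using C C' by (auto simp: coprod_central_def)
  have mid: "x \<otimes>\<^bsub>T 3\<^esub> p \<otimes>\<^bsub>T 3\<^esub> (q \<otimes>\<^bsub>T 3\<^esub> y) = x \<otimes>\<^bsub>T 3\<^esub> q \<otimes>\<^bsub>T 3\<^esub> (p \<otimes>\<^bsub>T 3\<^esub> y)"
    if "p \<otimes>\<^bsub>T 3\<^esub> q = q \<otimes>\<^bsub>T 3\<^esub> p" "x \<in> carrier (T 3)" "y \<in> carrier (T 3)" "p \<in> carrier (T 3)" "q \<in> carrier (T 3)" for x y p q
  proof -
    have "x \<otimes>\<^bsub>T 3\<^esub> p \<otimes>\<^bsub>T 3\<^esub> (q \<otimes>\<^bsub>T 3\<^esub> y) = x \<otimes>\<^bsub>T 3\<^esub> (p \<otimes>\<^bsub>T 3\<^esub> q) \<otimes>\<^bsub>T 3\<^esub> y"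
      using that(2-) by (simp add: T3.m_assoc)
    also have "\<dots> = x \<otimes>\<^bsub>T 3\<^esub> q \<otimes>\<^bsub>T 3\<^esub> (p \<otimes>\<^bsub>T 3\<^esub> y)"
      unfolding that(1) using that(2-) by (simp add: T3.m_assoc)
    finally show ?thesis .
  qed
  show "left_cocycle (C \<otimes>\<^bsub>T 2\<^esub> C') = left_cocycle C \<otimes>\<^bsub>T 3\<^esub> left_cocycle C'"
    unfolding left_cocycle_def using c
    by (simp add: alg_mapD(2) [OF coprod_at_algs(1)] alg_mapD(2) [OF rearrange_algs(2)])
      (intro mid coprod_central_coprod_at(1) C' c cocycle_closed)
  show "right_cocycle (C \<otimes>\<^bsub>T 2\<^esub> C') = right_cocycle C \<otimes>\<^bsub>T 3\<^esub> right_cocycle C'"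
    unfolding right_cocycle_def using c
    by (simp add: alg_mapD(2) [OF coprod_at_algs(2)] alg_mapD(2) [OF rearrange_algs(6)])
      (intro mid coprod_central_coprod_at(2) C' c cocycle_closed)
qed

lemma cocycle_one: "left_cocycle \<one>\<^bsub>T 2\<^esub> = \<one>\<^bsub>T 3\<^esub>" "right_cocycle \<one>\<^bsub>T 2\<^esub> = \<one>\<^bsub>T 3\<^esub>"
proof -
  interpret T3: monoid "T 3" by simp
  show "left_cocycle \<one>\<^bsub>T 2\<^esub> = \<one>\<^bsub>T 3\<^esub>" "right_cocycle \<one>\<^bsub>T 2\<^esub> = \<one>\<^bsub>T 3\<^esub>"
    by (simp_all add: left_cocycle_def right_cocycle_def alg_mapD(3) [OF coprod_at_algs(1)] alg_mapD(3) [OF coprod_at_algs(2)]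
      alg_mapD(3) [OF rearrange_algs(2)] alg_mapD(3) [OF rearrange_algs(6)])
qed

text \<open>
  In this form the cocycle condition reads \<open>\<Phi>\<^sup>-\<^sup>1 left_cocycle(C) \<Phi> = right_cocycle(C)\<close>, which is stable
  under products and inverses as both cocycles are multiplicative on elements that commute with
  coproducts.
\<close>

lemma compatible_twist_iff:
  "compatible_twist scale \<Delta> \<epsilon> \<Phi> C \<longleftrightarrow> C \<in> Units (T 2) \<and> counit_fst C = 1 \<and> counit_snd C = 1 \<and> coprod_central C
     \<and> left_cocycle C \<otimes>\<^bsub>T 3\<^esub> \<Phi> = \<Phi> \<otimes>\<^bsub>T 3\<^esub> right_cocycle C"
proof -
  interpret T2: monoid "T 2" by simp
  interpret T3: monoid "T 3" by simp
  show ?thesis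
    using assoc_invertible cocycle_closed [of C]
    by (auto simp: compatible_twist_def is_twist_def coprod_central_def left_cocycle_def right_cocycle_def T3.m_assoc T3.Units_closed T2.Units_closed)
qed

lemma compatible_twist_one: "compatible_twist scale \<Delta> \<epsilon> \<Phi> \<one>\<^bsub>T 2\<^esub>"
proof -
  interpret T2: monoid "T 2" by simp
  interpret T3: monoid "T 3" by simp
  show ?thesis
    using assoc_invertible
    by (simp add: compatible_twist_iff coprod_central_def coprod_closed cocycle_one T3.Units_closed
      alg_mapD(3) [OF contract_alg_map(1), simplified] alg_mapD(3) [OF contract_alg_map(2), simplified])
qed

lemma compatible_twist_mult:
  assumes "compatible_twist scale \<Delta> \<epsilon> \<Phi> C" "compatible_twist scale \<Delta> \<epsilon> \<Phi> C'"
  shows "compatible_twist scale \<Delta> \<epsilon> \<Phi> (C \<otimes>\<^bsub>T 2\<^esub> C')"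
proof -
  interpret T2: monoid "T 2" by simp
  interpret T3: monoid "T 3" by simp
  have C: "C \<in> Units (T 2)" "counit_fst C = 1" "counit_snd C = 1" "coprod_central C" "left_cocycle C \<otimes>\<^bsub>T 3\<^esub> \<Phi> = \<Phi> \<otimes>\<^bsub>T 3\<^esub> right_cocycle C"
    and C': "C' \<in> Units (T 2)" "counit_fst C' = 1" "counit_snd C' = 1" "coprod_central C'" "left_cocycle C' \<otimes>\<^bsub>T 3\<^esub> \<Phi> = \<Phi> \<otimes>\<^bsub>T 3\<^esub> right_cocycle C'"
    using assms by (auto simp: compatible_twist_iff)
  have c: "C \<in> carrier (T 2)" "C' \<in> carrier (T 2)" "\<Phi> \<in> carrier (T 3)" using C C' assoc_invertible by auto
  have "C \<otimes>\<^bsub>T 2\<^esub> C' \<otimes>\<^bsub>T 2\<^esub> \<Delta> a = \<Delta> a \<otimes>\<^bsub>T 2\<^esub> (C \<otimes>\<^bsub>T 2\<^esub> C')" for a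
  proof -
    have "C \<otimes>\<^bsub>T 2\<^esub> C' \<otimes>\<^bsub>T 2\<^esub> \<Delta> a = C \<otimes>\<^bsub>T 2\<^esub> \<Delta> a \<otimes>\<^bsub>T 2\<^esub> C'"
      using c coprod_closed C'(4) by (simp add: T2.m_assoc coprod_central_def)
    then show ?thesis using c coprod_closed C(4) by (simp add: T2.m_assoc [symmetric] coprod_central_def)
  qed
  then have cent: "coprod_central (C \<otimes>\<^bsub>T 2\<^esub> C')" using c by (simp add: coprod_central_def)
  have "left_cocycle C \<otimes>\<^bsub>T 3\<^esub> left_cocycle C' \<otimes>\<^bsub>T 3\<^esub> \<Phi> = left_cocycle C \<otimes>\<^bsub>T 3\<^esub> \<Phi> \<otimes>\<^bsub>T 3\<^esub> right_cocycle C'"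
    using c C'(5) by (simp add: T3.m_assoc cocycle_closed)
  also have "\<dots> = \<Phi> \<otimes>\<^bsub>T 3\<^esub> (right_cocycle C \<otimes>\<^bsub>T 3\<^esub> right_cocycle C')"
    using c C(5) by (simp add: T3.m_assoc cocycle_closed)
  finally show ?thesis
    using C C' c cent
    by (simp add: compatible_twist_iff cocycle_mult alg_mapD(2) [OF contract_alg_map(1)] alg_mapD(2) [OF contract_alg_map(2)])
qed

lemma compatible_twist_inv:
  assumes "compatible_twist scale \<Delta> \<epsilon> \<Phi> C"
  shows "compatible_twist scale \<Delta> \<epsilon> \<Phi> (inv\<^bsub>T 2\<^esub> C)"
proof -
  interpret T2: monoid "T 2" by simp
  interpret T3: monoid "T 3" by simp
  let ?I = "inv\<^bsub>T 2\<^esub> C"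
  have C: "C \<in> Units (T 2)" "counit_fst C = 1" "counit_snd C = 1" "coprod_central C" "left_cocycle C \<otimes>\<^bsub>T 3\<^esub> \<Phi> = \<Phi> \<otimes>\<^bsub>T 3\<^esub> right_cocycle C"
    using assms by (auto simp: compatible_twist_iff)
  have c: "C \<in> carrier (T 2)" "?I \<in> carrier (T 2)" "\<Phi> \<in> carrier (T 3)" using C assoc_invertible by auto
  have "?I \<otimes>\<^bsub>T 2\<^esub> \<Delta> a = \<Delta> a \<otimes>\<^bsub>T 2\<^esub> ?I" for a
  proof -
    have "?I \<otimes>\<^bsub>T 2\<^esub> \<Delta> a = ?I \<otimes>\<^bsub>T 2\<^esub> (\<Delta> a \<otimes>\<^bsub>T 2\<^esub> C) \<otimes>\<^bsub>T 2\<^esub> ?I"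
      using c C(1) coprod_closed by (simp add: T2.m_assoc)
    also have "\<dots> = ?I \<otimes>\<^bsub>T 2\<^esub> (C \<otimes>\<^bsub>T 2\<^esub> \<Delta> a) \<otimes>\<^bsub>T 2\<^esub> ?I"
      using C(4) by (simp add: coprod_central_def)
    also have "\<dots> = \<Delta> a \<otimes>\<^bsub>T 2\<^esub> ?I"
      using c C(1) coprod_closed by (simp add: T2.unit_cancel)
    finally show ?thesis .
  qed
  then have cent: "coprod_central ?I" using c by (simp add: coprod_central_def)
  have inv: "left_cocycle ?I \<otimes>\<^bsub>T 3\<^esub> left_cocycle C = \<one>\<^bsub>T 3\<^esub>" "right_cocycle C \<otimes>\<^bsub>T 3\<^esub> right_cocycle ?I = \<one>\<^bsub>T 3\<^esub>"
    using C(1) by (simp_all add: cocycle_mult [OF cent C(4), symmetric] cocycle_mult [OF C(4) cent, symmetric] cocycle_one)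
  have "left_cocycle ?I \<otimes>\<^bsub>T 3\<^esub> \<Phi> = left_cocycle ?I \<otimes>\<^bsub>T 3\<^esub> (\<Phi> \<otimes>\<^bsub>T 3\<^esub> right_cocycle C) \<otimes>\<^bsub>T 3\<^esub> right_cocycle ?I"
    using c by (simp add: T3.m_assoc cocycle_closed inv)
  also have "\<dots> = (left_cocycle ?I \<otimes>\<^bsub>T 3\<^esub> left_cocycle C) \<otimes>\<^bsub>T 3\<^esub> \<Phi> \<otimes>\<^bsub>T 3\<^esub> right_cocycle ?I"
    unfolding C(5) [symmetric] using c by (simp add: T3.m_assoc cocycle_closed)
  finally have KL: "left_cocycle ?I \<otimes>\<^bsub>T 3\<^esub> \<Phi> = \<Phi> \<otimes>\<^bsub>T 3\<^esub> right_cocycle ?I"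
    using c by (simp add: inv cocycle_closed)
  have "counit_fst ?I = counit_fst (?I \<otimes>\<^bsub>T 2\<^esub> C)" "counit_snd ?I = counit_snd (?I \<otimes>\<^bsub>T 2\<^esub> C)"
    using C(2,3) c by (simp_all add: alg_mapD(2) [OF contract_alg_map(1)] alg_mapD(2) [OF contract_alg_map(2)])
  then have "counit_fst ?I = 1" "counit_snd ?I = 1"
    using C(1) by (simp_all add: alg_mapD(3) [OF contract_alg_map(1)] alg_mapD(3) [OF contract_alg_map(2)])
  then show ?thesis
    using C(1) cent KL by (simp add: compatible_twist_iff)
qed

lemma compatible_twist_int_pow:
  assumes C: "compatible_twist scale \<Delta> \<epsilon> \<Phi> C"
  shows "compatible_twist scale \<Delta> \<epsilon> \<Phi> (C [^]\<^bsub>T 2\<^esub> (m :: int))"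
proof -
  interpret T2: monoid "T 2" by simp
  have "compatible_twist scale \<Delta> \<epsilon> \<Phi> (C [^]\<^bsub>T 2\<^esub> n)" for n :: nat
    by (induct n) (simp_all add: compatible_twist_one compatible_twist_mult C)
  then show ?thesis
    unfolding int_pow_def2 by (cases "m < 0") (simp_all only: if_True if_False compatible_twist_inv)
qed

end


section \<open>The monodromy of the R-matrix\<close>

context quasi_triangular_quasi_Hopf_algebra
begin

lemma assoc_R_units:
  "\<Phi> \<in> carrier (T 3)" "R \<in> carrier (T 2)"
  "unital_placement 3 3 g \<Longrightarrow> rearrange scale 3 g \<Phi> \<in> Units (T 3)"
  "unital_placement 2 3 g \<Longrightarrow> rearrange scale 3 g R \<in> Units (T 3)"
proof -
  interpret T2: monoid "T 2" by simp
  interpret T3: monoid "T 3" by simp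
  show "\<Phi> \<in> carrier (T 3)" "R \<in> carrier (T 2)" using assoc_invertible R_invertible by auto
  show "unital_placement 3 3 g \<Longrightarrow> rearrange scale 3 g \<Phi> \<in> Units (T 3)"
    "unital_placement 2 3 g \<Longrightarrow> rearrange scale 3 g R \<in> Units (T 3)"
    using assoc_invertible R_invertible
    by (auto intro: alg_map_unit(1) [OF rearrange_alg_map])
qed

text \<open>
  Under \<open>\<epsilon>\<close> on the second factor, the hexagon for \<open>(\<Delta> \<otimes> 1)R\<close> becomes \<open>R = R (1 \<otimes> (\<epsilon> \<otimes> 1)R)\<close>, because every
  associator then has \<open>\<epsilon>\<close> on its second or third leg. Under \<open>\<epsilon>\<close> on the third factor,
  the hexagon for \<open>(1 \<otimes> \<Delta>)R\<close> becomes \<open>R = ((1 \<otimes> \<epsilon>)R \<otimes> 1) R\<close> for the same reason.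
\<close>

lemma counit_R: "counit_fst R = 1" "counit_snd R = 1"
proof -
  interpret T2: monoid "T 2" by simp
  interpret T3: monoid "T 3" by simp
  note closed = assoc_R_units(1,2) T3.Units_closed [OF assoc_R_units(3)] T3.Units_closed [OF assoc_R_units(4)]
    T3.Units_inv_closed [OF assoc_R_units(3)] assoc_R_units(3) assoc_invertible
    T3.Units_inv_closed [OF assoc_invertible] unital_placements
  note E1 = alg_mapD(2) [OF counit_at_algs(1)] alg_map_unit(2) [OF counit_at_algs(1)]
  note E2 = alg_mapD(2) [OF counit_at_algs(2)] alg_map_unit(2) [OF counit_at_algs(2)]
  note evals = counit_at_rearrange assoc_counit_second assoc_counit_third alg_mapD(3) [OF flip_alg_map] counit_at_unit_insertion
  have pc: "pure [1, counit_fst R] \<in> carrier (T 2)" "pure [counit_snd R, 1] \<in> carrier (T 2)" by simp_all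
  have "R = counit_at 2 1 (coprod_at 2 0 R)"
    using counit_at_coprod_at(2) [of 0 2 R] assoc_R_units(2) by simp
  also have "\<dots> = R \<otimes>\<^bsub>T 2\<^esub> pure [1, counit_fst R]"
    unfolding coprod_left_R by (simp add: closed E1 evals pc)
  finally have "pure [1, counit_fst R] = \<one>\<^bsub>T 2\<^esub>" by (rule T2.unit_absorb(2) [OF R_invertible pc(1), OF sym])
  then have "counit_fst (pure [1, counit_fst R]) = 1" by (simp add: alg_mapD(3) [OF contract_alg_map(1)])
  then show "counit_fst R = 1" by (simp add: contract_pure counit_one word_simps)
  have "R = counit_at 2 2 (coprod_at 2 1 R)"
    using counit_at_coprod_at(2) [of 1 2 R] assoc_R_units(2) by simp
  also have "\<dots> = pure [counit_snd R, 1] \<otimes>\<^bsub>T 2\<^esub> R"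
    unfolding coprod_right_R by (simp add: closed E2 evals pc)
  finally have "pure [counit_snd R, 1] = \<one>\<^bsub>T 2\<^esub>" by (rule T2.unit_absorb(1) [OF R_invertible pc(2), OF sym])
  then have "counit_snd (pure [counit_snd R, 1]) = 1" by (simp add: alg_mapD(3) [OF contract_alg_map(2)])
  then show "counit_snd R = 1" by (simp add: contract_pure counit_one word_simps)
qed

lemma monodromy_compatible: "compatible_twist scale \<Delta> \<epsilon> \<Phi> (flip scale R \<otimes>\<^bsub>T 2\<^esub> R)"
proof -
  interpret T2: monoid "T 2" by simp
  interpret T3: monoid "T 3" by simp
  let ?C = "flip scale R \<otimes>\<^bsub>T 2\<^esub> R"
  note R = assoc_R_units(2) and \<Phi> = assoc_R_units(1)
  have F: "flip scale R \<in> Units (T 2)" by (rule alg_map_unit(1) [OF flip_alg_map]) (simp_all add: R_invertible)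
  then have Fc: "flip scale R \<in> carrier (T 2)" by auto
  have C: "?C \<in> carrier (T 2)" using R Fc by simp
  have "?C \<otimes>\<^bsub>T 2\<^esub> \<Delta> a = \<Delta> a \<otimes>\<^bsub>T 2\<^esub> ?C" for a
  proof -
    have fl: "flip scale (\<Delta> a) \<in> carrier (T 2)" by (rule alg_mapD(1) [OF flip_alg_map coprod_closed])
    have "?C \<otimes>\<^bsub>T 2\<^esub> \<Delta> a = flip scale R \<otimes>\<^bsub>T 2\<^esub> flip scale (\<Delta> a) \<otimes>\<^bsub>T 2\<^esub> R"
      using R Fc fl coprod_closed by (simp add: T2.m_assoc R_intertwines)
    also have "flip scale R \<otimes>\<^bsub>T 2\<^esub> flip scale (\<Delta> a) = flip scale (R \<otimes>\<^bsub>T 2\<^esub> \<Delta> a)"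
      by (simp add: R coprod_closed alg_mapD(2) [OF flip_alg_map])
    also have "\<dots> = \<Delta> a \<otimes>\<^bsub>T 2\<^esub> flip scale R"
      by (simp add: R_intertwines [symmetric] R coprod_closed fl alg_mapD(2) [OF flip_alg_map] flip_flip)
    finally show ?thesis using R Fc coprod_closed by (simp add: T2.m_assoc)
  qed
  then have cent: "coprod_central ?C" using C by (simp add: coprod_central_def)

  let ?\<tau> = "rearrange scale 3 (\<lambda>u. [u!1, u!0, u!2])"
  let ?P213 = "rearrange scale 3 (\<lambda>u. [u!1, u!0, u!2]) \<Phi>"
  let ?P312 = "rearrange scale 3 (\<lambda>u. [u!2, u!0, u!1]) \<Phi>"
  let ?P321 = "rearrange scale 3 (\<lambda>u. [u!2, u!1, u!0]) \<Phi>"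
  let ?r12 = "rearrange scale 3 (\<lambda>u. [u!0, u!1, 1]) R"
  let ?r21 = "rearrange scale 3 (\<lambda>u. [u!1, u!0, 1]) R"
  let ?r13 = "rearrange scale 3 (\<lambda>u. [u!0, 1, u!1]) R"
  let ?r31 = "rearrange scale 3 (\<lambda>u. [u!1, 1, u!0]) R"
  let ?r23 = "rearrange scale 3 (\<lambda>u. [1, u!0, u!1]) R"
  let ?r32 = "rearrange scale 3 (\<lambda>u. [1, u!1, u!0]) R"
  let ?c23 = "rearrange scale 3 (\<lambda>u. [1, u!0, u!1]) ?C"
  note units = assoc_R_units(3) assoc_R_units(4) unital_placements assoc_invertible
  note closed = units \<Phi> R T3.Units_closed [OF assoc_R_units(3)] T3.Units_closed [OF assoc_R_units(4)]
    T3.Units_inv_closed [OF assoc_R_units(3)] T3.Units_inv_closed [OF assoc_invertible] cocycle_closed C Fc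
  note compose = rearrange_rearrange [where n = 3 and m = 3 and l = 3]
    rearrange_rearrange [where n = 2 and m = 3 and l = 3] rearrange_rearrange [where n = 2 and m = 2 and l = 3]
  note perm = compose placements word_simps rearrange_id

  have D1F: "coprod_at 2 1 (flip scale R) = inv\<^bsub>T 3\<^esub> \<Phi> \<otimes>\<^bsub>T 3\<^esub> (?r21 \<otimes>\<^bsub>T 3\<^esub> (?P213 \<otimes>\<^bsub>T 3\<^esub> (?r31 \<otimes>\<^bsub>T 3\<^esub> inv\<^bsub>T 3\<^esub> ?P312)))"
    unfolding coprod_at_flip(2) [OF R] coprod_left_R
    by (simp add: closed alg_mapD(2) [OF rearrange_algs(12)] alg_map_unit(2) [OF rearrange_algs(12)] perm T3.m_assoc)
  have "?\<tau> (coprod_at 2 0 (flip scale R)) = rearrange scale 3 (\<lambda>u. [u!2, u!1, u!0]) (coprod_at 2 1 R)"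
    unfolding coprod_at_flip(1) [OF R] by (simp add: closed perm)
  also have "\<dots> = ?P213 \<otimes>\<^bsub>T 3\<^esub> (?r31 \<otimes>\<^bsub>T 3\<^esub> (inv\<^bsub>T 3\<^esub> ?P312 \<otimes>\<^bsub>T 3\<^esub> (?r32 \<otimes>\<^bsub>T 3\<^esub> ?P321)))"
    unfolding coprod_right_R
    by (simp add: closed alg_mapD(2) [OF rearrange_algs(13)] alg_map_unit(2) [OF rearrange_algs(13)] perm T3.m_assoc)
  finally have D0F: "?\<tau> (coprod_at 2 0 (flip scale R)) = \<dots>" .
  have D0R: "?\<tau> (coprod_at 2 0 R) = inv\<^bsub>T 3\<^esub> ?P321 \<otimes>\<^bsub>T 3\<^esub> (?r23 \<otimes>\<^bsub>T 3\<^esub> (?P312 \<otimes>\<^bsub>T 3\<^esub> (?r13 \<otimes>\<^bsub>T 3\<^esub> inv\<^bsub>T 3\<^esub> ?P213)))"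
    unfolding coprod_left_R
    by (simp add: closed alg_mapD(2) [OF rearrange_algs(10)] alg_map_unit(2) [OF rearrange_algs(10)] perm T3.m_assoc)
  have c23: "?c23 = ?r32 \<otimes>\<^bsub>T 3\<^esub> ?r23"
    unfolding flip_def using Fc
    by (simp add: closed alg_mapD(2) [OF rearrange_algs(6)] perm flip_def)
  (* The two associators with reversed legs meet and cancel here, which brings R\<^sub>3\<^sub>2 and R\<^sub>2\<^sub>3 together. *)
  have D0C: "?\<tau> (coprod_at 2 0 ?C) = ?P213 \<otimes>\<^bsub>T 3\<^esub> (?r31 \<otimes>\<^bsub>T 3\<^esub> (inv\<^bsub>T 3\<^esub> ?P312 \<otimes>\<^bsub>T 3\<^esub> (?c23 \<otimes>\<^bsub>T 3\<^esub> (?P312 \<otimes>\<^bsub>T 3\<^esub> (?r13 \<otimes>\<^bsub>T 3\<^esub> inv\<^bsub>T 3\<^esub> ?P213)))))"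
    unfolding c23
    by (simp add: closed alg_mapD(2) [OF rearrange_algs(10)] alg_mapD(2) [OF coprod_at_algs(1)] D0F D0R T3.m_assoc T3.unit_cancel)
  have braid: "?r12 \<otimes>\<^bsub>T 3\<^esub> coprod_at 2 0 ?C = ?\<tau> (coprod_at 2 0 ?C) \<otimes>\<^bsub>T 3\<^esub> ?r12"
    using coprod_at_intertwine [OF R flip_lin rearrange_lins(10) _ insertion_flip(1) R_intertwines [symmetric] C]
    by (simp add: insertion_unit R)
  have c12: "rearrange scale 3 (\<lambda>u. [u!0, u!1, 1]) ?C = ?r21 \<otimes>\<^bsub>T 3\<^esub> ?r12"
    unfolding flip_def using Fc
    by (simp add: closed alg_mapD(2) [OF rearrange_algs(2)] perm flip_def)
  have "left_cocycle ?C \<otimes>\<^bsub>T 3\<^esub> \<Phi> = ?r21 \<otimes>\<^bsub>T 3\<^esub> (?r12 \<otimes>\<^bsub>T 3\<^esub> coprod_at 2 0 ?C) \<otimes>\<^bsub>T 3\<^esub> \<Phi>"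
    by (simp add: left_cocycle_def c12 closed T3.m_assoc)
  also have "\<dots> = \<Phi> \<otimes>\<^bsub>T 3\<^esub> (coprod_at 2 1 (flip scale R) \<otimes>\<^bsub>T 3\<^esub> (?c23 \<otimes>\<^bsub>T 3\<^esub> coprod_at 2 1 R))"
    unfolding braid D0C D1F coprod_right_R
    by (simp add: closed T3.m_assoc T3.unit_cancel)
  also have "\<dots> = \<Phi> \<otimes>\<^bsub>T 3\<^esub> ((?c23 \<otimes>\<^bsub>T 3\<^esub> coprod_at 2 1 (flip scale R)) \<otimes>\<^bsub>T 3\<^esub> coprod_at 2 1 R)"
    unfolding coprod_central_coprod_at(2) [OF cent Fc] by (simp add: closed T3.m_assoc)
  also have "\<dots> = \<Phi> \<otimes>\<^bsub>T 3\<^esub> right_cocycle ?C"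
    by (simp add: right_cocycle_def closed T3.m_assoc alg_mapD(2) [OF coprod_at_algs(2)])
  finally have "left_cocycle ?C \<otimes>\<^bsub>T 3\<^esub> \<Phi> = \<Phi> \<otimes>\<^bsub>T 3\<^esub> right_cocycle ?C" .
  moreover have "counit_fst ?C = 1" "counit_snd ?C = 1"
    using R Fc by (simp_all add: alg_mapD(2) [OF contract_alg_map(1)] alg_mapD(2) [OF contract_alg_map(2)]
        contract_flip counit_R)
  ultimately show ?thesis
    using cent F R_invertible by (simp add: compatible_twist_iff)
qed

end

theorem mainTheorem9:
  fixes scale :: "'k::field \<Rightarrow> 'h::ring_1 \<Rightarrow> 'h"
    and \<Delta> :: "'h \<Rightarrow> ('h, 'k) tensor"
    and \<epsilon> :: "'h \<Rightarrow> 'k"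
    and \<Phi> R :: "('h, 'k) tensor"
    and S :: "'h \<Rightarrow> 'h"
    and \<alpha> \<beta> :: 'h
  assumes "quasi_triangular_quasi_Hopf_algebra scale \<Delta> \<epsilon> \<Phi> S \<alpha> \<beta> R"
  shows "compatible_twist scale \<Delta> \<epsilon> \<Phi> (flip scale R \<otimes>\<^bsub>tensor_power scale 2\<^esub> R)
    \<and> (\<forall>m::int. compatible_twist scale \<Delta> \<epsilon> \<Phi>
         ((flip scale R \<otimes>\<^bsub>tensor_power scale 2\<^esub> R) [^]\<^bsub>tensor_power scale 2\<^esub> m))"
proof -
  interpret quasi_triangular_quasi_Hopf_algebra scale \<Delta> \<epsilon> \<Phi> S \<alpha> \<beta> R by fact
  show ?thesis using monodromy_compatible compatible_twist_int_pow by blast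
qed

end
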